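(* Let $n,d\in\mathbb N$ and $\beta,\beta_1,\dots,\beta_n\ge-1$, and suppose that either $d\ge2$, or $d=1$ and $\beta,\beta_1,\dots,\beta_n\ne-1$. Let $\mathscr C=\mathrm{pos}(Z_1-Z,\dots,Z_n-Z)\sim\mathrm{BetaCone}(\mathbb R^d;\beta;\beta_1,\dots,\beta_n)$, with polar cone $\mathscr C^\circ=\{v\in\mathbb R^d:\langle v,z\rangle\le0\ \forall z\in\mathscr C\}$. Then $$\mathbb E\big[\alpha(\mathscr C^\circ)\mathbf 1_{\{\mathscr C\ne\mathbb R^d\}}\big]=\int_{-1}^{1}c_{\beta+\frac{d-1}2}(1-t^2)^{\beta+\frac{d-1}2}\prod_{j=1}^n\Big(\int_{-1}^tc_{\beta_j+\frac{d-1}2}(1-s^2)^{\beta_j+\frac{d-1}2}\,ds\Big)dt,$$ where $c_\beta=\frac{\Gamma(\beta+\frac32)}{\sqrt\pi\,\Gamma(\beta+1)}$.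
   Context: Beta distribution: for $d\in\mathbb N$ and $\beta>-1$, $f_{d,\beta}$ is the probability distribution on the unit ball $\mathbb B^d$ of $\mathbb R^d$ with Lebesgue density $c_{d,\beta}(1-\|x\|^2)^\beta\mathbf 1_{\{\|x\|<1\}}$, $c_{d,\beta}=\frac{\Gamma(\frac d2+\beta+1)}{\pi^{d/2}\Gamma(\beta+1)}$; $f_{d,-1}$ denotes the uniform distribution on the unit sphere $\mathbb S^{d-1}$. Beta cone: $\mathscr C=\mathrm{pos}(Z_1-Z,\dots,Z_n-Z)\sim\mathrm{BetaCone}(\mathbb R^d;\beta;\beta_1,\dots,\beta_n)$ means that $Z\sim f_{d,\beta},Z_1\sim f_{d,\beta_1},\dots,Z_n\sim f_{d,\beta_n}$ are independent; $\mathrm{pos}$ is the set of nonnegative linear combinations. Solid angle of a polyhedral cone: $\alpha(C)=\mathbb P[N\in C]$ with $N$ standard normal on the linear hull of $C$. *)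

theory Defs
  imports "HOL-Probability.Probability"
begin

text \<open>
  The space \<open>\<real>\<^sup>d\<close> is an arbitrary Euclidean space \<open>'a\<close> with \<open>d = DIM('a)\<close>.
\<close>

definition beta_const :: "nat \<Rightarrow> real \<Rightarrow> real" where
  "beta_const d \<beta> =
     Gamma (real d / 2 + \<beta> + 1) / (pi powr (real d / 2) * Gamma (\<beta> + 1))"

text \<open>
  Uniform distribution on the unit sphere as the normalised cone measure: the law of
  \<open>x / \<parallel>x\<parallel>\<close> for \<open>x\<close> uniform in the unit ball. (The centre, where \<open>sgn 0 = 0\<close>, is a null set.)
\<close>

definition uniform_sphere :: "'a::euclidean_space measure" where
  "uniform_sphere = distr (uniform_measure lborel (ball 0 1)) borel sgn"

definition beta_distr :: "real \<Rightarrow> 'a::euclidean_space measure" where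
  "beta_distr \<beta> =
     (if \<beta> = -1 then uniform_sphere
      else density lborel
        (\<lambda>x. ennreal (beta_const DIM('a) \<beta> * (1 - (norm x)\<^sup>2) powr \<beta> * indicator (ball 0 1) x)))"

definition pos :: "'a::real_vector set \<Rightarrow> 'a set" where
  "pos X = {\<Sum>x\<in>F. a x *\<^sub>R x | F a. finite F \<and> F \<subseteq> X \<and> (\<forall>x\<in>F. a x \<ge> (0::real))}"

definition polar_cone :: "'a::real_inner set \<Rightarrow> 'a set" where
  "polar_cone C = {v. \<forall>z\<in>C. v \<bullet> z \<le> 0}"

definition std_normal :: "'a::euclidean_space measure" where
  "std_normal =
     density lborel (\<lambda>x. ennreal ((2 * pi) powr (- real DIM('a) / 2) * exp (- (norm x)\<^sup>2 / 2)))"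

text \<open>
  The standard normal distribution on a linear subspace \<open>L\<close>, as the image of the standard normal
  distribution on the whole space under the orthogonal projection onto \<open>L\<close> (for a subspace,
  \<open>closest_point L\<close> is that projection). For \<open>L = {0}\<close> it is the point mass at \<open>0\<close>.
\<close>

definition std_normal_on :: "'a::euclidean_space set \<Rightarrow> 'a measure" where
  "std_normal_on L = distr std_normal borel (closest_point L)"

definition solid_angle :: "'a::euclidean_space set \<Rightarrow> real" where
  "solid_angle C = measure (std_normal_on (span C)) C"

text \<open>
  The random vectors generating a beta cone. For the joint independence, \<open>Z\<close> gets index \<open>0\<close> and
  \<open>Zs 1, \<dots>, Zs n\<close> keep their indices.
\<close>

definition beta_cone_vectors ::
  "'w measure \<Rightarrow> nat \<Rightarrow> real \<Rightarrow> (nat \<Rightarrow> real) \<Rightarrow>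
   ('w \<Rightarrow> 'a::euclidean_space) \<Rightarrow> (nat \<Rightarrow> 'w \<Rightarrow> 'a) \<Rightarrow> bool" where
  "beta_cone_vectors M n \<beta> \<beta>s Z Zs \<longleftrightarrow>
     prob_space.indep_vars M (\<lambda>_. borel) (\<lambda>i. if i = 0 then Z else Zs i) {0..n} \<and>
     distr M borel Z = beta_distr \<beta> \<and>
     (\<forall>j\<in>{1..n}. distr M borel (Zs j) = beta_distr (\<beta>s j))"

definition c_beta :: "real \<Rightarrow> real" where
  "c_beta \<beta> = Gamma (\<beta> + 3 / 2) / (sqrt pi * Gamma (\<beta> + 1))"

end

theory Submission
  imports Defs "HOL-Real_Asymp.Real_Asymp"
begin

text \<open>
  Almost surely the polar cone is either \<open>{0}\<close> or has nonempty interior, so up to a null event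
  \<open>\<alpha>(C\<degree>) 1{C \<noteq> \<real>\<^sup>d}\<close> is the mass of \<open>C\<degree>\<close> under the standard normal distribution on the whole
  space. By Fubini its expectation is the average over a normal vector \<open>N\<close> of
  \<open>P(\<langle>N, Z\<^sub>j\<rangle> \<le> \<langle>N, Z\<rangle> for all j)\<close>. Only the direction \<open>u\<close> of \<open>N\<close> matters, and the projection of
  a \<open>d\<close>-dimensional beta vector to any direction is one-dimensional beta with parameter
  \<open>\<beta> + (d - 1)/2\<close>; conditioning on \<open>\<langle>u, Z\<rangle> = t\<close> gives the right-hand side, whatever \<open>u\<close> is.

  The degenerate event: if \<open>C\<degree> \<noteq> {0}\<close> has empty interior, then by separation
  \<open>\<Sum>j. a\<^sub>j (Z\<^sub>j - Z) = 0\<close> for some nonzero \<open>a \<ge> 0\<close>, and any \<open>v \<noteq> 0\<close> in \<open>C\<degree>\<close> is orthogonal to all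
  \<open>Z\<^sub>j - Z\<close> with \<open>a\<^sub>j > 0\<close>. Hence one of these lies in a proper subspace spanned by the others, which
  is a null event since beta distributions do not charge hyperplanes.
\<close>

subsection \<open>Projections of beta distributions\<close>

lemma nn_integral_lborel_shift:
  fixes a :: "'a::euclidean_space"
  assumes [measurable]: "f \<in> borel_measurable borel"
  shows "(\<integral>\<^sup>+x. f (x + a) \<partial>lborel) = (\<integral>\<^sup>+x. f x \<partial>lborel)"
  by (subst (2) lborel_distr_plus[symmetric, of a]) (simp add: nn_integral_distr add.commute)

lemma nn_integral_lborel_scale:
  fixes f :: "'a::euclidean_space \<Rightarrow> ennreal"
  assumes [measurable]: "f \<in> borel_measurable borel" and "r > 0"
  shows "(\<integral>\<^sup>+x. f x \<partial>lborel) = ennreal (r ^ DIM('a)) * (\<integral>\<^sup>+x. f (r *\<^sub>R x) \<partial>lborel)"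
  using \<open>r > 0\<close>
  by (subst lborel_affine[of r 0])
     (simp_all add: nn_integral_density nn_integral_distr nn_integral_cmult ennreal_power)

text \<open>
  The factor \<open>indicator {0..1} (x \<bullet> u)\<close> has integral \<open>1\<close> along each line in direction \<open>u\<close>, so the inner
  integral is the \<open>(d - 1)\<close>-dimensional integral of \<open>g\<close> over \<open>{x. x \<bullet> u = s}\<close>. This form needs
  neither rotation invariance of Lebesgue measure nor coordinates on the hyperplane.
\<close>

lemma nn_integral_slices:
  fixes u :: "'a::euclidean_space"
  assumes g[measurable]: "g \<in> borel_measurable borel" and u: "norm u = 1"
  shows "(\<integral>\<^sup>+x. g x \<partial>lborel) =
    (\<integral>\<^sup>+s. \<integral>\<^sup>+x. indicator {0..1} (x \<bullet> u) * g (x + (s - x \<bullet> u) *\<^sub>R u) \<partial>lborel \<partial>lborel)"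
proof -
  have uu: "u \<bullet> u = 1" using u by (simp add: norm_eq_1)
  have "(\<integral>\<^sup>+s. \<integral>\<^sup>+x. indicator {0..1} (x \<bullet> u) * g (x + (s - x \<bullet> u) *\<^sub>R u) \<partial>lborel \<partial>lborel) =
    (\<integral>\<^sup>+x. \<integral>\<^sup>+s. indicator {0..1} (x \<bullet> u) * g (x + (s - x \<bullet> u) *\<^sub>R u) \<partial>lborel \<partial>lborel)"
    by (rule lborel_pair.Fubini') measurable
  \<comment> \<open>For fixed \<open>x\<close> the variable \<open>s\<close> is shifted by
    \<open>x \<bullet> u\<close>. After Fubini, for fixed \<open>s\<close>, a shift of
    \<open>x\<close> along \<open>u\<close> moves \<open>s\<close> from the argument of
    \<open>g\<close> into the indicator, which then restricts \<open>s\<close> to an interval of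
    length 1.\<close>
  also have "\<dots> = (\<integral>\<^sup>+x. \<integral>\<^sup>+s. indicator {0..1} (x \<bullet> u) * g (x + s *\<^sub>R u) \<partial>lborel \<partial>lborel)"
  proof (rule nn_integral_cong)
    fix x
    show "(\<integral>\<^sup>+s. indicator {0..1} (x \<bullet> u) * g (x + (s - x \<bullet> u) *\<^sub>R u) \<partial>lborel) =
      (\<integral>\<^sup>+s. indicator {0..1} (x \<bullet> u) * g (x + s *\<^sub>R u) \<partial>lborel)"
      using nn_integral_lborel_shift[of "\<lambda>s. indicator {0..1} (x \<bullet> u) * g (x + s *\<^sub>R u)" "- (x \<bullet> u)"]
      by simp
  qed
  also have "\<dots> = (\<integral>\<^sup>+s. \<integral>\<^sup>+x. indicator {0..1} (x \<bullet> u) * g (x + s *\<^sub>R u) \<partial>lborel \<partial>lborel)"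
    by (rule lborel_pair.Fubini'[symmetric]) measurable
  also have "\<dots> = (\<integral>\<^sup>+s. \<integral>\<^sup>+x. indicator {0..1} (x \<bullet> u - s) * g x \<partial>lborel \<partial>lborel)"
  proof (rule nn_integral_cong)
    fix s :: real
    show "(\<integral>\<^sup>+x. indicator {0..1} (x \<bullet> u) * g (x + s *\<^sub>R u) \<partial>lborel) =
      (\<integral>\<^sup>+x. indicator {0..1} (x \<bullet> u - s) * g x \<partial>lborel)"
      using nn_integral_lborel_shift[of "\<lambda>x. indicator {0..1} (x \<bullet> u - s) * g x" "s *\<^sub>R u"]
      by (simp add: inner_add_left uu)
  qed
  also have "\<dots> = (\<integral>\<^sup>+x. \<integral>\<^sup>+s. indicator {0..1} (x \<bullet> u - s) * g x \<partial>lborel \<partial>lborel)"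
    by (rule lborel_pair.Fubini') measurable
  also have "\<dots> = (\<integral>\<^sup>+x. g x \<partial>lborel)"
  proof (rule nn_integral_cong)
    fix x
    have "(\<integral>\<^sup>+s. indicator {0..1} (x \<bullet> u - s) * g x \<partial>lborel) =
      (\<integral>\<^sup>+s. indicator {x \<bullet> u - 1..x \<bullet> u} s * g x \<partial>lborel)"
      by (rule nn_integral_cong) (auto split: split_indicator)
    also have "\<dots> = g x"
      by (subst nn_integral_multc) auto
    finally show "(\<integral>\<^sup>+s. indicator {0..1} (x \<bullet> u - s) * g x \<partial>lborel) = g x" .
  qed
  finally show ?thesis by simp
qed

section \<open>Integration over hyperplanes by means of slabs\<close>

definition perp :: "'a::real_inner \<Rightarrow> 'a \<Rightarrow> 'a" where
  "perp u x = x - (x \<bullet> u) *\<^sub>R u"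

lemma perp_measurable[measurable]: "perp (u::'a::euclidean_space) \<in> borel_measurable borel"
  unfolding perp_def by measurable

lemma perp_scaleR: "perp u (r *\<^sub>R x) = r *\<^sub>R perp u x"
  by (simp add: perp_def algebra_simps)

lemma perp_shift: "norm u = 1 \<Longrightarrow> perp u (x + s *\<^sub>R u) = perp u x"
  by (simp add: perp_def algebra_simps inner_add_left norm_eq_1)

lemma norm_slice:
  "norm u = 1 \<Longrightarrow> (norm (x + (s - x \<bullet> u) *\<^sub>R u))\<^sup>2 = s\<^sup>2 + (norm (perp u x))\<^sup>2"
  unfolding perp_def power2_norm_eq_inner norm_eq_1
  by (simp add: algebra_simps inner_add_left inner_diff_left inner_add_right inner_diff_right
      inner_commute[of u x] power2_eq_square)

lemma inner_slice: "norm u = 1 \<Longrightarrow> (x + (s - x \<bullet> u) *\<^sub>R u) \<bullet> u = s"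
  by (simp add: norm_eq_1 inner_add_left)

text \<open>For a unit vector \<open>u\<close> this is the (d - 1)-dimensional integral of
  \<open>\<psi>\<close> over the hyperplane orthogonal to \<open>u\<close>:
  \<open>\<psi> (perp u x)\<close> is constant along \<open>u\<close> and the slab has width 1. For
  d = 1 it is the value \<open>\<psi> 0\<close>.\<close>

definition slab_integral :: "'a::euclidean_space \<Rightarrow> ('a \<Rightarrow> ennreal) \<Rightarrow> ennreal" where
  "slab_integral u \<psi> = (\<integral>\<^sup>+x. indicator {0..1} (x \<bullet> u) * \<psi> (perp u x) \<partial>lborel)"

text \<open>After slicing, every height \<open>s\<close> in \<open>{0..a}\<close> contributes the
  same amount, so the integral is proportional to the width.\<close>

lemma slab_integral_width:
  fixes u :: "'a::euclidean_space"
  assumes [measurable]: "\<psi> \<in> borel_measurable borel" and u: "norm u = 1" and "a \<ge> 0"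
  shows "(\<integral>\<^sup>+x. indicator {0..a} (x \<bullet> u) * \<psi> (perp u x) \<partial>lborel) = ennreal a * slab_integral u \<psi>"
proof -
  have "(\<integral>\<^sup>+x. indicator {0..a} (x \<bullet> u) * \<psi> (perp u x) \<partial>lborel) =
    (\<integral>\<^sup>+s. \<integral>\<^sup>+x. indicator {0..1} (x \<bullet> u) * (indicator {0..a} s * \<psi> (perp u x)) \<partial>lborel \<partial>lborel)"
    by (subst nn_integral_slices[OF _ u]) (simp_all add: inner_slice perp_shift u)
  also have "\<dots> = (\<integral>\<^sup>+s. indicator {0..a} s * slab_integral u \<psi> \<partial>lborel)"
    unfolding slab_integral_def
    by (subst nn_integral_cmult[symmetric]) (auto simp: mult.left_commute)
  also have "\<dots> = ennreal a * slab_integral u \<psi>"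
    using \<open>a \<ge> 0\<close> by (subst nn_integral_multc) auto
  finally show ?thesis .
qed

text \<open>Dilating the whole space gives the factor \<open>r ^ DIM('a)\<close>, while the dilated
  slab keeps only width \<open>1/r\<close>. The form with \<open>powr\<close> lets the factor merge
  with real powers of \<open>1 - s\<^sup>2\<close> later.\<close>

lemma slab_integral_scale:
  fixes u :: "'a::euclidean_space"
  assumes [measurable]: "\<psi> \<in> borel_measurable borel" and u: "norm u = 1" and r: "r > 0"
  shows "slab_integral u (\<lambda>y. \<psi> (y /\<^sub>R r)) = ennreal (r powr (real DIM('a) - 1)) * slab_integral u \<psi>"
proof -
  have "slab_integral u (\<lambda>y. \<psi> (y /\<^sub>R r)) =
    ennreal (r ^ DIM('a)) * (\<integral>\<^sup>+x. indicator {0..1} (r * (x \<bullet> u)) * \<psi> (perp u x) \<partial>lborel)"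
    unfolding slab_integral_def using r
    by (subst nn_integral_lborel_scale[OF _ r]) (simp_all add: perp_scaleR)
  also have "(\<integral>\<^sup>+x. indicator {0..1} (r * (x \<bullet> u)) * \<psi> (perp u x) \<partial>lborel) =
    (\<integral>\<^sup>+x. indicator {0..1/r} (x \<bullet> u) * \<psi> (perp u x) \<partial>lborel)"
    using r by (intro nn_integral_cong) (auto split: split_indicator simp: field_simps zero_le_mult_iff)
  also have "\<dots> = ennreal (1/r) * slab_integral u \<psi>"
    using r by (intro slab_integral_width u) auto
  also have "ennreal (r ^ DIM('a)) * (ennreal (1/r) * slab_integral u \<psi>) =
     ennreal (r ^ DIM('a) * (1 / r)) * slab_integral u \<psi>"
    using r by (simp add: ennreal_mult mult.assoc del: times_divide_eq_right)
  also have "r ^ DIM('a) * (1 / r) = r powr (real DIM('a) - 1)"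
    using r by (simp add: powr_diff powr_realpow)
  finally show ?thesis .
qed

text \<open>At height \<open>s\<close> the unit ball cuts out a (d - 1)-ball of radius
  \<open>sqrt (1 - s\<^sup>2)\<close>. Rescaling it to radius 1 takes
  \<open>(1 - s\<^sup>2) powr \<beta>\<close> out of the density and exponent (d - 1)/2 out of the
  hyperplane measure. The remaining slab integral depends on neither \<open>s\<close> nor
  \<open>h\<close> and stays uncomputed.\<close>

lemma nn_integral_beta_projection:
  fixes u :: "'a::euclidean_space"
  assumes h[measurable]: "h \<in> borel_measurable borel" and u: "norm u = 1"
  shows "(\<integral>\<^sup>+x. ennreal ((1 - (norm x)\<^sup>2) powr \<beta> * indicator (ball 0 1) x) * h (x \<bullet> u) \<partial>lborel) =
    slab_integral u (\<lambda>y. ennreal ((1 - (norm y)\<^sup>2) powr \<beta> * indicator (ball 0 1) y)) *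
    (\<integral>\<^sup>+s. ennreal ((1 - s\<^sup>2) powr (\<beta> + (real DIM('a) - 1) / 2) * indicator {-1..1} s) * h s \<partial>lborel)"
    (is "_ = slab_integral u ?\<psi> * _")
proof -
  have [measurable]: "ball (0::'a) 1 \<in> sets borel" by simp
  have \<psi>: "?\<psi> \<in> borel_measurable borel" by measurable
  have ball: "indicator (ball 0 1) y = indicator {..<1} ((norm y)\<^sup>2)" for y :: 'a
    by (auto split: split_indicator simp: power_less_one_iff abs_square_less_1)
  have inner: "(\<integral>\<^sup>+x. indicator {0..1} (x \<bullet> u) * (ennreal ((1 - (s\<^sup>2 + (norm (perp u x))\<^sup>2)) powr \<beta> *
        indicator {..<1} (s\<^sup>2 + (norm (perp u x))\<^sup>2)) * h s) \<partial>lborel) =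
      slab_integral u ?\<psi> * (ennreal ((1 - s\<^sup>2) powr (\<beta> + (real DIM('a) - 1) / 2) * indicator {-1..1} s) * h s)" for s
  proof (cases "\<bar>s\<bar> < 1")
    case False
    have z1: "indicator {..<1} (s\<^sup>2 + (norm (perp u x))\<^sup>2) = (0::real)" for x
    proof -
      have "1 \<le> s\<^sup>2" using False by (simp add: abs_square_less_1[symmetric] not_less)
      then have "1 \<le> s\<^sup>2 + (norm (perp u x))\<^sup>2" by (smt (verit) zero_le_power2)
      then show ?thesis by auto
    qed
    \<comment> \<open>The closed indicator does not cut off \<open>s = 1\<close> and
      \<open>s = -1\<close>; there the value is 0 because \<open>0 powr x = 0\<close> for every
      exponent, also a negative one.\<close>
    have z2: "(1 - s\<^sup>2) powr (\<beta> + (real DIM('a) - 1) / 2) * indicator {-1..1} s = 0"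
      using False by (cases "s = 1 \<or> s = -1") (auto split: split_indicator)
    show ?thesis by (subst z2, simp add: z1)
  next
    case True
    define r where "r = sqrt (1 - s\<^sup>2)"
    have s2: "s\<^sup>2 < 1" using True by (simp add: abs_square_less_1)
    have r: "r > 0" "r\<^sup>2 = 1 - s\<^sup>2" using s2 by (auto simp: r_def)
    have eq: "ennreal ((1 - (s\<^sup>2 + (norm y)\<^sup>2)) powr \<beta> * indicator {..<1} (s\<^sup>2 + (norm y)\<^sup>2)) =
      ennreal ((1 - s\<^sup>2) powr \<beta>) * ?\<psi> (y /\<^sub>R r)" for y :: 'a
    proof -
      have n: "(norm (y /\<^sub>R r))\<^sup>2 = (norm y)\<^sup>2 / (1 - s\<^sup>2)"
        using r by (simp add: power_mult_distrib power_inverse divide_inverse mult.commute)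
      have i: "indicator {..<1} (s\<^sup>2 + (norm y)\<^sup>2) = (indicator {..<1} ((norm (y /\<^sub>R r))\<^sup>2) :: real)"
        unfolding n using s2 by (auto split: split_indicator simp: field_simps)
      have p: "(1 - (s\<^sup>2 + (norm y)\<^sup>2)) powr \<beta> = (1 - s\<^sup>2) powr \<beta> * (1 - (norm (y /\<^sub>R r))\<^sup>2) powr \<beta>"
        if "s\<^sup>2 + (norm y)\<^sup>2 < 1"
      proof -
        have "1 - (s\<^sup>2 + (norm y)\<^sup>2) = (1 - s\<^sup>2) * (1 - (norm (y /\<^sub>R r))\<^sup>2)"
          unfolding n using s2 by (simp add: field_simps)
        moreover have "0 \<le> 1 - (norm (y /\<^sub>R r))\<^sup>2"
          unfolding n using s2 that by (simp add: field_simps)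
        ultimately show ?thesis using s2 by (simp add: powr_mult)
      qed
      show ?thesis
        unfolding ball ennreal_mult'[symmetric, OF powr_ge_zero] i
        using p i by (auto split: split_indicator_asm split_indicator simp: mult_ac)
    qed
    have "(\<integral>\<^sup>+x. indicator {0..1} (x \<bullet> u) * (ennreal ((1 - (s\<^sup>2 + (norm (perp u x))\<^sup>2)) powr \<beta> *
        indicator {..<1} (s\<^sup>2 + (norm (perp u x))\<^sup>2)) * h s) \<partial>lborel) =
       (\<integral>\<^sup>+x. (ennreal ((1 - s\<^sup>2) powr \<beta>) * h s) * (indicator {0..1} (x \<bullet> u) * ?\<psi> (perp u x /\<^sub>R r)) \<partial>lborel)"
      unfolding eq by (intro nn_integral_cong) (simp only: mult_ac)
    also have "\<dots> = (ennreal ((1 - s\<^sup>2) powr \<beta>) * h s) * slab_integral u (\<lambda>y. ?\<psi> (y /\<^sub>R r))"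
      unfolding slab_integral_def by (subst nn_integral_cmult) auto
    also have "\<dots> = (ennreal ((1 - s\<^sup>2) powr \<beta>) * ennreal (r powr (real DIM('a) - 1))) * h s * slab_integral u ?\<psi>"
      by (subst slab_integral_scale[OF \<psi> u r(1)]) (simp only: mult_ac)
    also have "ennreal ((1 - s\<^sup>2) powr \<beta>) * ennreal (r powr (real DIM('a) - 1)) =
       ennreal ((1 - s\<^sup>2) powr (\<beta> + (real DIM('a) - 1) / 2) * indicator {-1..1} s)"
    proof -
      have "r powr (real DIM('a) - 1) = (1 - s\<^sup>2) powr ((real DIM('a) - 1) / 2)"
        using s2 by (simp add: r_def powr_half_sqrt[symmetric] powr_powr)
      then show ?thesis using True by (simp add: ennreal_mult'[symmetric] powr_add indicator_def abs_less_iff)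
    qed
    finally show ?thesis by (simp only: mult_ac)
  qed
  have "(\<integral>\<^sup>+x. ennreal ((1 - (norm x)\<^sup>2) powr \<beta> * indicator (ball 0 1) x) * h (x \<bullet> u) \<partial>lborel) =
    (\<integral>\<^sup>+s. (\<integral>\<^sup>+x. indicator {0..1} (x \<bullet> u) * (ennreal ((1 - (s\<^sup>2 + (norm (perp u x))\<^sup>2)) powr \<beta> *
        indicator {..<1} (s\<^sup>2 + (norm (perp u x))\<^sup>2)) * h s) \<partial>lborel) \<partial>lborel)"
    unfolding ball by (subst nn_integral_slices[OF _ u]) (simp_all add: norm_slice inner_slice u)
  also have "\<dots> = slab_integral u ?\<psi> *
    (\<integral>\<^sup>+s. ennreal ((1 - s\<^sup>2) powr (\<beta> + (real DIM('a) - 1) / 2) * indicator {-1..1} s) * h s \<partial>lborel)"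
    unfolding inner by (rule nn_integral_cmult) measurable
  finally show ?thesis .
qed

section \<open>Projection of the uniform distribution on the sphere\<close>

text \<open>The map \<open>g\<close> takes the cosine \<open>t\<close> of the angle with an axis to
  the height on a parallel line at distance 1, and its derivative is the weight. Since both blow up
  at the ends, the substitution rule is applied on compact intervals exhausting the open one, and
  both sides pass to the limit by monotone convergence.\<close>

lemma nn_integral_sphere_substitution:
  assumes G[measurable]: "G \<in> borel_measurable borel"
  shows "(\<integral>\<^sup>+s. G s \<partial>lborel) =
    (\<integral>\<^sup>+t. ennreal ((1 - t\<^sup>2) powr (- 3 / 2) * indicator {-1<..<1} t) * G (t / sqrt (1 - t\<^sup>2)) \<partial>lborel)"
proof -
  \<comment> \<open>The shift by 2 makes \<open>a 0 = 1/2\<close>, so every interval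
    \<open>{- a k..a k}\<close> is nondegenerate and stays strictly between -1 and 1.\<close>
  define a :: "nat \<Rightarrow> real" where "a k = 1 - 1 / (real k + 2)" for k
  define g :: "real \<Rightarrow> real" where "g t = t / sqrt (1 - t\<^sup>2)" for t
  define g' :: "real \<Rightarrow> real" where "g' t = (1 - t\<^sup>2) powr (- 3 / 2)" for t
  have a: "0 < a k" "a k < 1" for k by (auto simp: a_def field_simps)
  have a_mono: "incseq a" by (intro monoI) (auto simp: a_def frac_le)
  have a_lim: "a \<longlonglongrightarrow> 1" unfolding a_def by real_asymp
  have sq: "t\<^sup>2 < 1" if "t \<in> {- a k..a k}" for t k
    using that a[of k] by (auto simp: abs_square_less_1)
  have deriv: "(g has_real_derivative g' t) (at t)" if "t\<^sup>2 < 1" for t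
  proof -
    define w where "w = sqrt (1 - t\<^sup>2)"
    have w: "w > 0" "w * w = 1 - t\<^sup>2" using that by (auto simp: w_def)
    have p: "(1 - t\<^sup>2) powr (- 3 / 2) = 1 / (w * w * w)"
    proof -
      have "(1 - t\<^sup>2) powr (- 3 / 2) = w powr (-3)"
        using that by (simp add: w_def powr_half_sqrt[symmetric] powr_powr)
      also have "\<dots> = 1 / (w * w * w)"
        using w by (simp add: powr_minus_divide powr_numeral power3_eq_cube)
      finally show ?thesis .
    qed
    have "(g has_real_derivative (1 * w - t * (inverse w / 2 * (- (2 * t)))) / (w * w)) (at t)"
      unfolding g_def w_def using that
      by (auto intro!: derivative_eq_intros simp: power2_eq_square)
    also have "(1 * w - t * (inverse w / 2 * (- (2 * t)))) / (w * w) = g' t"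
      unfolding g'_def p using w by (simp add: field_simps power2_eq_square)
    finally show ?thesis .
  qed
  have cont: "continuous_on {- a k..a k} g'" for k
    unfolding g'_def using sq[of _ k] by (intro continuous_intros) force+
  have step: "(\<integral>\<^sup>+s. G s * indicator {g (- a k)..g (a k)} s \<partial>lborel) =
      (\<integral>\<^sup>+t. G (g t) * g' t * indicator {- a k..a k} t \<partial>lborel)" for k
    using a[of k] sq[of _ k]
    by (intro nn_integral_substitution_aux deriv cont) (auto simp: g'_def)
  have g_meas[measurable]: "g \<in> borel_measurable borel" "g' \<in> borel_measurable borel"
    unfolding g_def g'_def by measurable
  have gm: "g (- t) = - g t" for t by (simp add: g_def)
  have g_mono: "incseq (\<lambda>k. g (a k))"
  proof (rule incseq_SucI)
    fix k
    have "a k \<le> a (Suc k)" using a_mono by (simp add: incseq_SucD)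
    moreover have "(a k)\<^sup>2 \<le> (a (Suc k))\<^sup>2" using a[of k] calculation by (intro power_mono) auto
    moreover have "(a (Suc k))\<^sup>2 < 1" using sq[of "a (Suc k)" "Suc k"] a[of "Suc k"] by auto
    ultimately show "g (a k) \<le> g (a (Suc k))"
      unfolding g_def using a[of "Suc k"] a[of k] by (intro frac_le) auto
  qed
  have g_lim: "filterlim (\<lambda>k. g (a k)) at_top sequentially"
    unfolding g_def a_def by real_asymp
  have ev_a: "\<exists>k. \<bar>t\<bar> \<le> a k" if "\<bar>t\<bar> < 1" for t
    using order_tendstoD(1)[OF a_lim that] by (metis eventually_sequentially less_imp_le order_refl)
  have ev_g: "\<exists>k. \<bar>t\<bar> \<le> g (a k)" for t
    using g_lim unfolding filterlim_at_top by (metis eventually_sequentially order_refl)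
  have L: "(\<integral>\<^sup>+s. G s \<partial>lborel) = (SUP k. \<integral>\<^sup>+s. G s * indicator {g (- a k)..g (a k)} s \<partial>lborel)"
  proof (subst nn_integral_monotone_convergence_SUP[symmetric])
    show "incseq (\<lambda>k s. G s * indicator {g (- a k)..g (a k)} s)"
    proof (intro incseq_SucI le_funI)
      fix k s
      show "G s * indicator {g (- a k)..g (a k)} s \<le> G s * indicator {g (- a (Suc k))..g (a (Suc k))} s"
        using incseq_SucD[OF g_mono, of k] by (auto simp: gm split: split_indicator)
    qed
    show "(\<integral>\<^sup>+s. G s \<partial>lborel) = (\<integral>\<^sup>+s. (SUP k. G s * indicator {g (- a k)..g (a k)} s) \<partial>lborel)"
    proof (rule nn_integral_cong)
      fix s
      obtain k where k: "\<bar>s\<bar> \<le> g (a k)" using ev_g by blast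
      show "G s = (SUP k. G s * indicator {g (- a k)..g (a k)} s)"
        by (rule antisym)
           (use k in \<open>auto intro!: SUP_upper2[of k] SUP_least simp: gm split: split_indicator\<close>)
    qed
  qed measurable
  have R: "(\<integral>\<^sup>+t. G (g t) * g' t * indicator {-1<..<1} t \<partial>lborel) =
     (SUP k. \<integral>\<^sup>+t. G (g t) * g' t * indicator {- a k..a k} t \<partial>lborel)"
  proof (subst nn_integral_monotone_convergence_SUP[symmetric])
    show "incseq (\<lambda>k t. G (g t) * g' t * indicator {- a k..a k} t)"
    proof (intro incseq_SucI le_funI)
      fix k t
      show "G (g t) * g' t * indicator {- a k..a k} t \<le> G (g t) * g' t * indicator {- a (Suc k)..a (Suc k)} t"
        using incseq_SucD[OF a_mono, of k] by (auto split: split_indicator)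
    qed
    show "(\<integral>\<^sup>+t. G (g t) * g' t * indicator {-1<..<1} t \<partial>lborel) =
      (\<integral>\<^sup>+t. (SUP k. G (g t) * g' t * indicator {- a k..a k} t) \<partial>lborel)"
    proof (rule nn_integral_cong)
      fix t
      show "G (g t) * g' t * indicator {-1<..<1} t = (SUP k. G (g t) * g' t * indicator {- a k..a k} t)"
      proof (cases "\<bar>t\<bar> < 1")
        case True
        obtain k where k: "\<bar>t\<bar> \<le> a k" using ev_a True by blast
        show ?thesis
          by (rule antisym)
             (use k True in \<open>auto intro!: SUP_upper2[of k] SUP_least split: split_indicator\<close>)
      next
        case False
        have "\<not> (- a k \<le> t \<and> t \<le> a k)" for k using a[of k] False by auto
        then show ?thesis using False by (auto split: split_indicator)
      qed
    qed
  qed measurable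
  have "(\<integral>\<^sup>+s. G s \<partial>lborel) = (\<integral>\<^sup>+t. G (g t) * g' t * indicator {-1<..<1} t \<partial>lborel)"
    unfolding L R step ..
  also have "\<dots> = (\<integral>\<^sup>+t. ennreal ((1 - t\<^sup>2) powr (- 3 / 2) * indicator {-1<..<1} t) * G (t / sqrt (1 - t\<^sup>2)) \<partial>lborel)"
    by (intro nn_integral_cong) (auto simp: g_def g'_def mult.commute split: split_indicator)
  finally show ?thesis .
qed

text \<open>This integrates along a line at distance \<open>\<rho>\<close> from the axis. Scaling by
  \<open>\<rho>\<close> reduces it to distance 1, and the norm condition becomes
  \<open>\<rho>\<^sup>2 / (1 - t\<^sup>2) < 1\<close> because \<open>s\<^sup>2 + 1\<close> turns
  into \<open>1 / (1 - t\<^sup>2)\<close>.\<close>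

lemma nn_integral_sphere_line:
  assumes h[measurable]: "h \<in> borel_measurable borel" and \<rho>: "\<rho> > 0"
  shows "(\<integral>\<^sup>+s. indicator {..<1} (s\<^sup>2 + \<rho>\<^sup>2) * h (s / sqrt (s\<^sup>2 + \<rho>\<^sup>2)) \<partial>lborel) =
    (\<integral>\<^sup>+t. ennreal ((1 - t\<^sup>2) powr (- 3 / 2) * indicator {-1<..<1} t) * h t *
      ennreal (\<rho> * indicator {..<1} (\<rho>\<^sup>2 / (1 - t\<^sup>2))) \<partial>lborel)"
proof -
  define G where "G s = indicator {..<1} (\<rho>\<^sup>2 * (s\<^sup>2 + 1)) * h (s / sqrt (s\<^sup>2 + 1))" for s
  have [measurable]: "G \<in> borel_measurable borel" unfolding G_def by measurable
  have "(\<integral>\<^sup>+s. indicator {..<1} (s\<^sup>2 + \<rho>\<^sup>2) * h (s / sqrt (s\<^sup>2 + \<rho>\<^sup>2)) \<partial>lborel) =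
    ennreal \<bar>\<rho>\<bar> * (\<integral>\<^sup>+s. indicator {..<1} ((0 + \<rho> * s)\<^sup>2 + \<rho>\<^sup>2) * h ((0 + \<rho> * s) / sqrt ((0 + \<rho> * s)\<^sup>2 + \<rho>\<^sup>2)) \<partial>lborel)"
    using \<rho> by (intro nn_integral_real_affine) auto
  also have "\<dots> = ennreal \<rho> * (\<integral>\<^sup>+s. G s \<partial>lborel)"
  proof -
    have "(\<rho> * s)\<^sup>2 + \<rho>\<^sup>2 = \<rho>\<^sup>2 * (s\<^sup>2 + 1)" for s by (simp add: algebra_simps power_mult_distrib)
    then show ?thesis using \<rho> by (simp add: G_def real_sqrt_mult)
  qed
  also have "(\<integral>\<^sup>+s. G s \<partial>lborel) = (\<integral>\<^sup>+t. ennreal ((1 - t\<^sup>2) powr (- 3 / 2) * indicator {-1<..<1} t) * G (t / sqrt (1 - t\<^sup>2)) \<partial>lborel)"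
    by (rule nn_integral_sphere_substitution) measurable
  also have "ennreal \<rho> * \<dots> = (\<integral>\<^sup>+t. ennreal \<rho> * (ennreal ((1 - t\<^sup>2) powr (- 3 / 2) * indicator {-1<..<1} t) * G (t / sqrt (1 - t\<^sup>2))) \<partial>lborel)"
    by (rule nn_integral_cmult[symmetric]) measurable
  also have "\<dots> = (\<integral>\<^sup>+t. ennreal ((1 - t\<^sup>2) powr (- 3 / 2) * indicator {-1<..<1} t) * h t *
      ennreal (\<rho> * indicator {..<1} (\<rho>\<^sup>2 / (1 - t\<^sup>2))) \<partial>lborel)"
  proof (rule nn_integral_cong)
    fix t :: real
    show "ennreal \<rho> * (ennreal ((1 - t\<^sup>2) powr (- 3 / 2) * indicator {-1<..<1} t) * G (t / sqrt (1 - t\<^sup>2))) =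
      ennreal ((1 - t\<^sup>2) powr (- 3 / 2) * indicator {-1<..<1} t) * h t *
      ennreal (\<rho> * indicator {..<1} (\<rho>\<^sup>2 / (1 - t\<^sup>2)))"
    proof (cases "t \<in> {-1<..<1}")
      case True
      then have t: "1 - t\<^sup>2 > 0" using abs_square_less_1[of t] by auto
      have e: "(t / sqrt (1 - t\<^sup>2))\<^sup>2 + 1 = 1 / (1 - t\<^sup>2)"
        using t by (simp add: power_divide field_simps)
      have "G (t / sqrt (1 - t\<^sup>2)) = indicator {..<1} (\<rho>\<^sup>2 / (1 - t\<^sup>2)) * h t"
        unfolding G_def e using t by (simp add: real_sqrt_divide)
      moreover have "ennreal (\<rho> * indicator {..<1} (\<rho>\<^sup>2 / (1 - t\<^sup>2))) = ennreal \<rho> * indicator {..<1} (\<rho>\<^sup>2 / (1 - t\<^sup>2))"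
        by (auto split: split_indicator)
      ultimately show ?thesis by (simp only: mult_ac)
    qed simp
  qed
  finally show ?thesis .
qed

text \<open>The zeros of \<open>perp u\<close> are multiples of \<open>u\<close>; from dimension 2
  on they lie in a hyperplane through 0, which is a null set.\<close>

lemma AE_perp_neq_0:
  fixes u :: "'a::euclidean_space"
  assumes "DIM('a) \<ge> 2" and u: "norm u = 1"
  shows "AE x in lborel. perp u x \<noteq> 0"
proof -
  have "dim {u} < DIM('a)" using assms dim_le_card[of "{u}"] by simp
  then obtain v where v: "v \<noteq> 0" "\<And>y. y \<in> span {u} \<Longrightarrow> orthogonal v y"
    using orthogonal_to_subspace_exists by blast
  then have "v \<bullet> u = 0" by (simp add: orthogonal_def span_base)
  then have sub: "{x. perp u x = 0} \<subseteq> {x. v \<bullet> x = 0}"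
    by (auto simp: perp_def) (metis inner_scaleR_right mult_zero_right)
  have "{x. v \<bullet> x = 0} \<in> null_sets lebesgue"
    using negligible_hyperplane[of v 0] v by (simp add: negligible_iff_null_sets)
  then have "{x. v \<bullet> x = 0} \<in> null_sets lborel"
    by (subst (asm) null_sets_completion_iff) auto
  then show ?thesis by (rule AE_I') (use sub in auto)
qed

text \<open>On each line parallel to \<open>u\<close> the height is replaced by the cosine
  \<open>t\<close>. For fixed \<open>t\<close> the hyperplane integral is rescaled by
  \<open>r = sqrt (1 - t\<^sup>2)\<close>: one factor \<open>r\<close> comes from the distance to
  the axis, d - 1 from the hyperplane measure. The exponents -3/2 and d/2 add up to -1 + (d - 1)/2,
  so the sphere fits the general formula with \<beta> = -1.\<close>

lemma nn_integral_sphere_projection: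
  fixes u :: "'a::euclidean_space"
  assumes h[measurable]: "h \<in> borel_measurable borel" and u: "norm u = 1" and d: "DIM('a) \<ge> 2"
  shows "(\<integral>\<^sup>+x. indicator (ball 0 1) x * h (sgn x \<bullet> u) \<partial>lborel) =
    slab_integral u (\<lambda>y. ennreal (norm y * indicator (ball 0 1) y)) *
    (\<integral>\<^sup>+s. ennreal ((1 - s\<^sup>2) powr (-1 + (real DIM('a) - 1) / 2) * indicator {-1..1} s) * h s \<partial>lborel)"
    (is "_ = slab_integral u ?\<psi> * _")
proof -
  have [measurable]: "ball (0::'a) 1 \<in> sets borel" by simp
  have \<psi>: "?\<psi> \<in> borel_measurable borel" by measurable
  have ball: "indicator (ball 0 1) y = (indicator {..<1} ((norm y)\<^sup>2) :: ennreal)"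
    and ballr: "indicator (ball 0 1) y = (indicator {..<1} ((norm y)\<^sup>2) :: real)" for y :: 'a
    by (auto split: split_indicator simp: power_less_one_iff abs_square_less_1)
  have sgn: "sgn y \<bullet> u = (y \<bullet> u) / sqrt ((norm y)\<^sup>2)" for y :: 'a
    by (simp add: sgn_div_norm divide_inverse mult.commute)
  let ?w = "\<lambda>t. ennreal ((1 - t\<^sup>2) powr (- 3 / 2) * indicator {-1<..<1} t) * h t"
  let ?p = "\<lambda>x t. ennreal (norm (perp u x) * indicator {..<1} ((norm (perp u x))\<^sup>2 / (1 - t\<^sup>2)))"
  have slab: "(\<integral>\<^sup>+x. indicator {0..1} (x \<bullet> u) * (?w t * ?p x t) \<partial>lborel) =
      slab_integral u ?\<psi> * (ennreal ((1 - t\<^sup>2) powr (-1 + (real DIM('a) - 1) / 2) * indicator {-1..1} t) * h t)" for t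
  proof (cases "t \<in> {-1<..<1}")
    case False
    then show ?thesis by (cases "t = 1 \<or> t = -1") (auto split: split_indicator)
  next
    case True
    define r where "r = sqrt (1 - t\<^sup>2)"
    have t2: "t\<^sup>2 < 1" using True abs_square_less_1[of t] by auto
    have r: "r > 0" "r\<^sup>2 = 1 - t\<^sup>2" using t2 by (auto simp: r_def)
    have eq: "?p x t = ennreal r * ?\<psi> (perp u x /\<^sub>R r)" for x
    proof -
      have n: "(norm (perp u x /\<^sub>R r))\<^sup>2 = (norm (perp u x))\<^sup>2 / (1 - t\<^sup>2)"
        using r by (simp add: power_mult_distrib power_inverse divide_inverse mult.commute)
      show ?thesis
        unfolding ballr n using r by (simp add: ennreal_mult'[symmetric] field_simps)
    qed
    have "(\<integral>\<^sup>+x. indicator {0..1} (x \<bullet> u) * (?w t * ?p x t) \<partial>lborel) =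
      (\<integral>\<^sup>+x. ?w t * ennreal r * (indicator {0..1} (x \<bullet> u) * ?\<psi> (perp u x /\<^sub>R r)) \<partial>lborel)"
      unfolding eq by (intro nn_integral_cong) (simp only: mult_ac)
    also have "\<dots> = ?w t * ennreal r * slab_integral u (\<lambda>y. ?\<psi> (y /\<^sub>R r))"
      unfolding slab_integral_def by (subst nn_integral_cmult) auto
    also have "\<dots> = ?w t * (ennreal r * ennreal (r powr (real DIM('a) - 1))) * slab_integral u ?\<psi>"
      by (subst slab_integral_scale[OF \<psi> u r(1)]) (simp only: mult_ac)
    also have "ennreal r * ennreal (r powr (real DIM('a) - 1)) = ennreal ((1 - t\<^sup>2) powr (real DIM('a) / 2))"
    proof -
      have "r * r powr (real DIM('a) - 1) = r powr (real DIM('a))"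
        using r by (simp add: powr_diff)
      also have "\<dots> = (1 - t\<^sup>2) powr (real DIM('a) / 2)"
        using t2 by (simp add: r_def powr_half_sqrt[symmetric] powr_powr)
      finally show ?thesis using r by (simp add: ennreal_mult'[symmetric])
    qed
    also have "?w t * ennreal ((1 - t\<^sup>2) powr (real DIM('a) / 2)) =
      ennreal ((1 - t\<^sup>2) powr (-1 + (real DIM('a) - 1) / 2) * indicator {-1..1} t) * h t"
    proof -
      have "(1 - t\<^sup>2) powr (- 3 / 2) * (1 - t\<^sup>2) powr (real DIM('a) / 2) = (1 - t\<^sup>2) powr (-1 + (real DIM('a) - 1) / 2)"
        by (simp add: powr_add[symmetric] field_simps)
      then have "ennreal ((1 - t\<^sup>2) powr (- 3 / 2)) * ennreal ((1 - t\<^sup>2) powr (real DIM('a) / 2)) =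
        ennreal ((1 - t\<^sup>2) powr (-1 + (real DIM('a) - 1) / 2))"
        by (simp add: ennreal_mult'[symmetric])
      moreover have "indicator {-1<..<1} t = (1::real)" "indicator {-1..1} t = (1::real)"
        using True by auto
      ultimately show ?thesis by (simp add: mult_ac)
    qed
    finally show ?thesis by (simp only: mult_ac)
  qed
  have "(\<integral>\<^sup>+x. indicator (ball 0 1) x * h (sgn x \<bullet> u) \<partial>lborel) =
    (\<integral>\<^sup>+s. \<integral>\<^sup>+x. indicator {0..1} (x \<bullet> u) * (indicator {..<1} (s\<^sup>2 + (norm (perp u x))\<^sup>2) *
       h (s / sqrt (s\<^sup>2 + (norm (perp u x))\<^sup>2))) \<partial>lborel \<partial>lborel)"
    unfolding ball sgn by (subst nn_integral_slices[OF _ u]) (simp_all only: norm_slice inner_slice u, measurable)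
  also have "\<dots> = (\<integral>\<^sup>+x. \<integral>\<^sup>+s. indicator {0..1} (x \<bullet> u) * (indicator {..<1} (s\<^sup>2 + (norm (perp u x))\<^sup>2) *
       h (s / sqrt (s\<^sup>2 + (norm (perp u x))\<^sup>2))) \<partial>lborel \<partial>lborel)"
    by (rule lborel_pair.Fubini') measurable
  \<comment> \<open>The change of variable needs a positive distance to the axis, which almost every
    \<open>x\<close> has in dimension at least 2.\<close>
  also have "\<dots> = (\<integral>\<^sup>+x. \<integral>\<^sup>+t. indicator {0..1} (x \<bullet> u) * (?w t * ?p x t) \<partial>lborel \<partial>lborel)"
    using AE_perp_neq_0[OF d u]
  proof (intro nn_integral_cong_AE, eventually_elim)
    fix x assume "perp u x \<noteq> 0"
    then have \<rho>: "norm (perp u x) > 0" by simp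
    show "(\<integral>\<^sup>+s. indicator {0..1} (x \<bullet> u) * (indicator {..<1} (s\<^sup>2 + (norm (perp u x))\<^sup>2) *
       h (s / sqrt (s\<^sup>2 + (norm (perp u x))\<^sup>2))) \<partial>lborel) = (\<integral>\<^sup>+t. indicator {0..1} (x \<bullet> u) * (?w t * ?p x t) \<partial>lborel)"
      using nn_integral_sphere_line[OF h \<rho>] by (subst (1 2) nn_integral_cmult) simp_all
  qed
  also have "\<dots> = (\<integral>\<^sup>+t. \<integral>\<^sup>+x. indicator {0..1} (x \<bullet> u) * (?w t * ?p x t) \<partial>lborel \<partial>lborel)"
    by (rule lborel_pair.Fubini'[symmetric]) measurable
  also have "\<dots> = slab_integral u ?\<psi> *
    (\<integral>\<^sup>+s. ennreal ((1 - s\<^sup>2) powr (-1 + (real DIM('a) - 1) / 2) * indicator {-1..1} s) * h s \<partial>lborel)"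
    unfolding slab by (rule nn_integral_cmult) measurable
  finally show ?thesis .
qed

section \<open>Normalising constants and one-dimensional marginals\<close>

lemma c_beta_pos: "\<gamma> > -1 \<Longrightarrow> c_beta \<gamma> > 0"
  unfolding c_beta_def by (intro divide_pos_pos mult_pos_pos Gamma_real_pos) auto

text \<open>This is the Legendre duplication formula at \<open>\<gamma> + 1\<close>: it trades
  \<open>Gamma (2 * (\<gamma> + 1))\<close> in the Beta function for
  \<open>Gamma (\<gamma> + 3/2)\<close>, and its power of 2 cancels
  \<open>2 * 4 powr \<gamma>\<close>.\<close>

lemma Beta_symmetric_c_beta:
  assumes "\<gamma> > -1"
  shows "2 * 4 powr \<gamma> * Beta (\<gamma> + 1) (\<gamma> + 1) = 1 / c_beta \<gamma>"
proof -
  have G: "Gamma (\<gamma> + 1) > 0" "Gamma (\<gamma> + 3/2) > 0" "Gamma (2 * (\<gamma> + 1)) > 0"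
    using assms by (auto intro!: Gamma_real_pos)
  have np: "complex_of_real (\<gamma> + 1) \<notin> \<int>\<^sub>\<le>\<^sub>0" "complex_of_real (\<gamma> + 1) + 1/2 \<notin> \<int>\<^sub>\<le>\<^sub>0"
  proof -
    show "complex_of_real (\<gamma> + 1) \<notin> \<int>\<^sub>\<le>\<^sub>0"
      using assms by (subst of_real_in_nonpos_Ints_iff) (auto elim!: nonpos_Ints_cases)
    have "complex_of_real (\<gamma> + 1 + 1/2) \<notin> \<int>\<^sub>\<le>\<^sub>0"
      using assms by (subst of_real_in_nonpos_Ints_iff) (auto elim!: nonpos_Ints_cases)
    then show "complex_of_real (\<gamma> + 1) + 1/2 \<notin> \<int>\<^sub>\<le>\<^sub>0" by simp
  qed
  have "complex_of_real (Gamma (\<gamma> + 1) * Gamma (\<gamma> + 1 + 1/2)) =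
    complex_of_real (exp ((1 - 2 * (\<gamma> + 1)) * ln 2) * sqrt pi * Gamma (2 * (\<gamma> + 1)))"
    using Gamma_legendre_duplication[OF np]
    by (simp add: Gamma_complex_of_real[symmetric] exp_of_real[symmetric])
  then have dup: "Gamma (\<gamma> + 1) * Gamma (\<gamma> + 1 + 1/2) =
    exp ((1 - 2 * (\<gamma> + 1)) * ln 2) * sqrt pi * Gamma (2 * (\<gamma> + 1))"
    unfolding of_real_eq_iff .
  have "2 * 4 powr \<gamma> * exp ((1 - 2 * (\<gamma> + 1)) * ln 2) = exp (ln 2 + \<gamma> * ln 4 + (1 - 2 * (\<gamma> + 1)) * ln (2::real))"
    by (simp add: powr_def exp_add)
  also have "ln (4::real) = 2 * ln 2" using ln_realpow[of 2 2] by simp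
  finally have e: "2 * 4 powr \<gamma> * exp ((1 - 2 * (\<gamma> + 1)) * ln (2::real)) = 1" by (simp add: algebra_simps)
  have "2 * 4 powr \<gamma> * (Gamma (\<gamma> + 1) * Gamma (\<gamma> + 3/2)) = sqrt pi * Gamma (2 * (\<gamma> + 1))"
    using dup e by (simp add: add.assoc)
  then show ?thesis using G by (simp add: Beta_def c_beta_def field_simps)
qed

text \<open>Substituting \<open>t = -1 + 2 * x\<close> gives
  \<open>1 - t\<^sup>2 = 4 * (x * (1 - x))\<close> and thus a Beta integral with equal
  arguments.\<close>

lemma nn_integral_beta_normalise:
  assumes "\<gamma> > -1"
  shows "(\<integral>\<^sup>+t. ennreal ((1 - t\<^sup>2) powr \<gamma> * indicator {-1..1} t) \<partial>lborel) = ennreal (1 / c_beta \<gamma>)"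
proof -
  define B where "B = Beta (\<gamma> + 1) (\<gamma> + 1)"
  have "(\<integral>\<^sup>+t. ennreal ((1 - t\<^sup>2) powr \<gamma> * indicator {-1..1} t) \<partial>lborel) =
    ennreal \<bar>2\<bar> * (\<integral>\<^sup>+x. ennreal ((1 - (-1 + 2 * x)\<^sup>2) powr \<gamma> * indicator {-1..1} (-1 + 2 * x)) \<partial>lborel)"
    by (rule nn_integral_real_affine) auto
  also have "(\<integral>\<^sup>+x. ennreal ((1 - (-1 + 2 * x)\<^sup>2) powr \<gamma> * indicator {-1..1} (-1 + 2 * x)) \<partial>lborel) =
    (\<integral>\<^sup>+x. ennreal (4 powr \<gamma>) * (ennreal (x powr (\<gamma> + 1 - 1) * (1 - x) powr (\<gamma> + 1 - 1)) * indicator {0..1} x) \<partial>lborel)"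
  proof (rule nn_integral_cong)
    fix x :: real
    have "(1 - (-1 + 2 * x)\<^sup>2) powr \<gamma> = 4 powr \<gamma> * (x powr \<gamma> * (1 - x) powr \<gamma>)" if "x \<in> {0..1}"
    proof -
      have "1 - (-1 + 2 * x)\<^sup>2 = 4 * (x * (1 - x))" by (simp add: power2_eq_square algebra_simps)
      then show ?thesis using that by (simp add: powr_mult)
    qed
    moreover have "-1 + 2 * x \<in> {-1..1} \<longleftrightarrow> x \<in> {0..1}" by auto
    ultimately show "ennreal ((1 - (-1 + 2 * x)\<^sup>2) powr \<gamma> * indicator {-1..1} (-1 + 2 * x)) =
      ennreal (4 powr \<gamma>) * (ennreal (x powr (\<gamma> + 1 - 1) * (1 - x) powr (\<gamma> + 1 - 1)) * indicator {0..1} x)"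
      by (cases "x \<in> {0..1}") (auto simp: indicator_def ennreal_mult')
  qed
  also have "\<dots> = ennreal (4 powr \<gamma>) * (\<integral>\<^sup>+x. ennreal (x powr (\<gamma> + 1 - 1) * (1 - x) powr (\<gamma> + 1 - 1)) * indicator {0..1} x \<partial>lborel)"
    by (rule nn_integral_cmult) measurable
  also have "(\<integral>\<^sup>+x. ennreal (x powr (\<gamma> + 1 - 1) * (1 - x) powr (\<gamma> + 1 - 1)) * indicator {0..1} x \<partial>lborel) = ennreal B"
    unfolding B_def
    using nn_integral_has_integral_lebesgue[OF _ has_integral_Beta_real[of "\<gamma> + 1" "\<gamma> + 1"]] assms
    by (simp add: nn_integral_completion mult.commute ennreal_indicator[symmetric] ennreal_mult'[symmetric] del: ennreal_indicator)
  also have "ennreal \<bar>2\<bar> * (ennreal (4 powr \<gamma>) * ennreal B) = ennreal (2 * 4 powr \<gamma> * B)"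
    by (simp add: ennreal_mult'[symmetric] mult.assoc del: ennreal_numeral)
  finally show ?thesis using Beta_symmetric_c_beta[OF assms] by (simp add: B_def)
qed

text \<open>Testing with the constant function 1 forces \<open>K = c_beta \<gamma>\<close>. Hence
  slab integrals, the volume of the ball and \<open>beta_const\<close> never have to be
  evaluated.\<close>

lemma distr_eq_beta_density:
  assumes N: "prob_space N" and [measurable]: "X \<in> borel_measurable N" and \<gamma>: "\<gamma> > -1"
    and K: "\<And>h. h \<in> borel_measurable borel \<Longrightarrow> (\<integral>\<^sup>+x. h (X x) \<partial>N) =
      K * (\<integral>\<^sup>+s. ennreal ((1 - s\<^sup>2) powr \<gamma> * indicator {-1..1} s) * h s \<partial>lborel)"
  shows "distr N borel X =
    density lborel (\<lambda>s. ennreal (c_beta \<gamma> * ((1 - s\<^sup>2) powr \<gamma> * indicator {-1..1} s)))"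
proof -
  interpret prob_space N by fact
  have c: "c_beta \<gamma> > 0" using \<gamma> by (rule c_beta_pos)
  have "1 = K * ennreal (1 / c_beta \<gamma>)"
    using K[of "\<lambda>_. 1"] by (simp add: nn_integral_beta_normalise[OF \<gamma>] emeasure_space_1)
  then have "ennreal (c_beta \<gamma>) = K * (ennreal (c_beta \<gamma>) * ennreal (1 / c_beta \<gamma>))"
    by (metis mult.left_commute mult.right_neutral)
  also have "ennreal (c_beta \<gamma>) * ennreal (1 / c_beta \<gamma>) = 1"
    using c by (simp add: ennreal_mult'[symmetric])
  finally have K_eq: "K = ennreal (c_beta \<gamma>)" by simp
  show ?thesis
  proof (rule measure_eqI)
    fix A assume "A \<in> sets (distr N borel X)"
    then have [measurable]: "A \<in> sets borel" by simp
    have "emeasure (distr N borel X) A = (\<integral>\<^sup>+x. indicator A (X x) \<partial>N)"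
      by (simp add: nn_integral_indicator[symmetric] nn_integral_distr del: nn_integral_indicator)
    also have "\<dots> = ennreal (c_beta \<gamma>) * (\<integral>\<^sup>+s. ennreal ((1 - s\<^sup>2) powr \<gamma> * indicator {-1..1} s) * indicator A s \<partial>lborel)"
      by (subst K) (auto simp: K_eq)
    also have "\<dots> = (\<integral>\<^sup>+s. ennreal (c_beta \<gamma> * ((1 - s\<^sup>2) powr \<gamma> * indicator {-1..1} s)) * indicator A s \<partial>lborel)"
      using c by (subst nn_integral_cmult[symmetric]) (auto simp: ennreal_mult' mult.assoc)
    also have "\<dots> = emeasure (density lborel (\<lambda>s. ennreal (c_beta \<gamma> * ((1 - s\<^sup>2) powr \<gamma> * indicator {-1..1} s)))) A"
      by (rule emeasure_density[symmetric]) auto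
    finally show "emeasure (distr N borel X) A = \<dots>" .
  qed simp
qed

lemma sets_beta_distr[measurable_cong, simp]: "sets (beta_distr \<beta>) = sets borel"
  by (simp add: beta_distr_def uniform_sphere_def)

text \<open>The two projection formulas determine the marginal up to a constant factor, which total
  mass 1 fixes. In the application \<open>prob\<close> holds because the measure is the law of a
  random vector.\<close>

lemma beta_distr_marginal:
  fixes u :: "'a::euclidean_space"
  assumes prob: "prob_space (beta_distr \<beta> :: 'a measure)" and \<beta>: "\<beta> \<ge> -1"
    and d: "DIM('a) \<ge> 2 \<or> \<beta> \<noteq> -1" and u: "norm u = 1"
  defines "\<gamma> \<equiv> \<beta> + (real DIM('a) - 1) / 2"
  shows "distr (beta_distr \<beta>) borel (\<lambda>x. x \<bullet> u) =
    density lborel (\<lambda>s. ennreal (c_beta \<gamma> * ((1 - s\<^sup>2) powr \<gamma> * indicator {-1..1} s)))"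
proof -
  have [measurable]: "ball (0::'a) 1 \<in> sets borel" by simp
  have "real DIM('a) \<ge> 1" using DIM_positive[where 'a='a] by linarith
  moreover have "real DIM('a) \<ge> 2 \<or> \<beta> > -1" using \<beta> d by auto
  \<comment> \<open>In dimension 1 the summand \<open>(real DIM('a) - 1) / 2\<close> is 0 and
    \<open>\<beta> > -1\<close>; from dimension 2 on it is at least 1/2, which makes up for
    \<open>\<beta> = -1\<close>.\<close>
  ultimately have \<gamma>: "\<gamma> > -1" unfolding \<gamma>_def using \<beta> by argo
  have [measurable]: "(sgn :: 'a \<Rightarrow> 'a) \<in> borel_measurable borel"
    unfolding sgn_div_norm[abs_def] by measurable
  show ?thesis
  proof (cases "\<beta> = -1")
    case True
    let ?B = "ball (0::'a) 1"
    have "(\<integral>\<^sup>+x. h (x \<bullet> u) \<partial>beta_distr \<beta>) =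
      (slab_integral u (\<lambda>y. ennreal (norm y * indicator ?B y)) / emeasure lborel ?B) *
      (\<integral>\<^sup>+s. ennreal ((1 - s\<^sup>2) powr \<gamma> * indicator {-1..1} s) * h s \<partial>lborel)"
      if [measurable]: "h \<in> borel_measurable borel" for h
    proof -
      have "(\<integral>\<^sup>+x. h (x \<bullet> u) \<partial>beta_distr \<beta>) =
        (\<integral>\<^sup>+x. indicator ?B x * h (sgn x \<bullet> u) \<partial>lborel) / emeasure lborel ?B"
        using True by (simp add: beta_distr_def uniform_sphere_def nn_integral_distr
            nn_integral_uniform_measure mult.commute)
      also have "\<dots> = slab_integral u (\<lambda>y. ennreal (norm y * indicator ?B y)) *
        (\<integral>\<^sup>+s. ennreal ((1 - s\<^sup>2) powr \<gamma> * indicator {-1..1} s) * h s \<partial>lborel) / emeasure lborel ?B"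
        using True d by (subst nn_integral_sphere_projection[OF that u]) (auto simp: \<gamma>_def)
      finally show ?thesis by (simp add: divide_ennreal_def mult_ac)
    qed
    then show ?thesis using prob \<gamma> by (intro distr_eq_beta_density) auto
  next
    case False
    define c where "c = beta_const DIM('a) \<beta>"
    have c: "c \<ge> 0"
      unfolding c_def beta_const_def using \<beta> False
      by (intro divide_nonneg_nonneg mult_nonneg_nonneg less_imp_le[OF Gamma_real_pos]) auto
    have "(\<integral>\<^sup>+x. h (x \<bullet> u) \<partial>beta_distr \<beta>) =
      ennreal c * slab_integral u (\<lambda>y. ennreal ((1 - (norm y)\<^sup>2) powr \<beta> * indicator (ball 0 1) y)) *
      (\<integral>\<^sup>+s. ennreal ((1 - s\<^sup>2) powr \<gamma> * indicator {-1..1} s) * h s \<partial>lborel)"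
      if [measurable]: "h \<in> borel_measurable borel" for h
    proof -
      have "(\<integral>\<^sup>+x. h (x \<bullet> u) \<partial>beta_distr \<beta>) =
        (\<integral>\<^sup>+x. ennreal c * (ennreal ((1 - (norm x)\<^sup>2) powr \<beta> * indicator (ball 0 1) x) * h (x \<bullet> u)) \<partial>lborel)"
        using False c by (simp add: beta_distr_def nn_integral_density c_def[symmetric] mult.assoc ennreal_mult')
      also have "\<dots> = ennreal c * (\<integral>\<^sup>+x. ennreal ((1 - (norm x)\<^sup>2) powr \<beta> * indicator (ball 0 1) x) * h (x \<bullet> u) \<partial>lborel)"
        by (rule nn_integral_cmult) measurable
      finally show ?thesis unfolding nn_integral_beta_projection[OF that u] \<gamma>_def by (simp only: mult.assoc)
    qed
    then show ?thesis using prob \<gamma> by (intro distr_eq_beta_density) auto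
  qed
qed

subsection \<open>Polar cones of finitely generated cones\<close>

text \<open>\<open>pos\<close> takes a set, whereas the generators form a family that may repeat
  vectors. One direction picks one index per vector, the other adds the coefficients of all indices
  with the same vector.\<close>

lemma pos_image:
  fixes w :: "'i \<Rightarrow> 'a::real_vector"
  assumes "finite J"
  shows "pos (w ` J) = {\<Sum>j\<in>J. a j *\<^sub>R w j | a. \<forall>j\<in>J. a j \<ge> 0}"
proof (intro set_eqI iffI)
  fix y assume "y \<in> pos (w ` J)"
  then obtain F c where F: "finite F" "F \<subseteq> w ` J" "\<forall>x\<in>F. c x \<ge> (0::real)"
    and y: "y = (\<Sum>x\<in>F. c x *\<^sub>R x)"
    unfolding pos_def by blast
  obtain I where I: "I \<subseteq> J" "inj_on w I" "F = w ` I"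
    using F(2) by (metis subset_image_inj)
  have "y = (\<Sum>i\<in>I. c (w i) *\<^sub>R w i)"
    unfolding y I(3) using I(2) by (simp add: sum.reindex)
  also have "\<dots> = (\<Sum>j\<in>J. (if j \<in> I then c (w j) else 0) *\<^sub>R w j)"
    using I(1) assms by (intro sum.mono_neutral_cong_left) auto
  finally show "y \<in> {\<Sum>j\<in>J. a j *\<^sub>R w j | a. \<forall>j\<in>J. a j \<ge> 0}"
    using F(3) I(3) by (auto intro!: exI[of _ "\<lambda>j. if j \<in> I then c (w j) else 0"])
next
  fix y assume "y \<in> {\<Sum>j\<in>J. a j *\<^sub>R w j | a. \<forall>j\<in>J. a j \<ge> 0}"
  then obtain a where a: "\<forall>j\<in>J. a j \<ge> (0::real)" and y: "y = (\<Sum>j\<in>J. a j *\<^sub>R w j)" by blast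
  have "y = (\<Sum>x\<in>w ` J. (\<Sum>j | j \<in> J \<and> w j = x. a j) *\<^sub>R x)"
    unfolding y using assms by (subst sum.image_gen[OF assms, of _ w]) (auto simp: scaleR_sum_left intro!: sum.cong)
  then show "y \<in> pos (w ` J)"
    unfolding pos_def using a assms
    by (intro CollectI exI[of _ "w ` J"] exI[of _ "\<lambda>x. \<Sum>j | j \<in> J \<and> w j = x. a j"])
       (auto intro!: sum_nonneg)
qed

text \<open>The identification gives access to the algebra of convex cone hulls and, for finitely
  many generators, to their closedness, on which the separation in \<open>farkas\<close>
  relies.\<close>

lemma pos_image_eq_hull:
  fixes w :: "'i \<Rightarrow> 'a::real_vector"
  assumes "finite J"
  shows "pos (w ` J) = convex_cone hull (w ` J)"
proof
  have "(\<Sum>j\<in>I. a j *\<^sub>R w j) \<in> convex_cone hull (w ` J)"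
    if "finite I" "I \<subseteq> J" "\<forall>j\<in>J. a j \<ge> 0" for I and a :: "'i \<Rightarrow> real"
    using that
    by (induction I rule: finite_induct)
       (auto simp: convex_cone_hull_contains_0 hull_inc intro!: convex_cone_hull_add convex_cone_hull_mul)
  then show "pos (w ` J) \<subseteq> convex_cone hull (w ` J)"
    unfolding pos_image[OF assms] using assms by auto
  show "convex_cone hull (w ` J) \<subseteq> pos (w ` J)"
  proof (rule hull_minimal)
    show "w ` J \<subseteq> pos (w ` J)"
    proof
      fix x assume x: "x \<in> w ` J"
      show "x \<in> pos (w ` J)"
        unfolding pos_def using x by (auto intro!: exI[of _ "{x}"] exI[of _ "\<lambda>_. 1"])
    qed
    have 0: "0 \<in> pos (w ` J)"
      unfolding pos_def by (auto intro!: exI[of _ "{}"])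
    have add: "x + y \<in> pos (w ` J)" if xy: "x \<in> pos (w ` J)" "y \<in> pos (w ` J)" for x y
    proof -
      obtain a b where "\<forall>j\<in>J. a j \<ge> (0::real)" "x = (\<Sum>j\<in>J. a j *\<^sub>R w j)"
        "\<forall>j\<in>J. b j \<ge> (0::real)" "y = (\<Sum>j\<in>J. b j *\<^sub>R w j)"
        using xy unfolding pos_image[OF assms] by blast
      then show ?thesis
        unfolding pos_image[OF assms]
        by (intro CollectI exI[of _ "\<lambda>j. a j + b j"]) (auto simp: scaleR_add_left sum.distrib)
    qed
    have mul: "c *\<^sub>R x \<in> pos (w ` J)" if x: "x \<in> pos (w ` J)" and c: "c \<ge> 0" for x c
    proof -
      obtain a where "\<forall>j\<in>J. a j \<ge> (0::real)" "x = (\<Sum>j\<in>J. a j *\<^sub>R w j)"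
        using x unfolding pos_image[OF assms] by blast
      then show ?thesis
        unfolding pos_image[OF assms] using c
        by (intro CollectI exI[of _ "\<lambda>j. c * a j"]) (auto simp: scaleR_sum_right)
    qed
    show "convex_cone (pos (w ` J))"
      unfolding convex_cone_iff using 0 add mul by auto
  qed
qed

lemma polar_cone_pos_image:
  fixes w :: "'i \<Rightarrow> 'a::real_inner"
  assumes "finite J"
  shows "polar_cone (pos (w ` J)) = {v. \<forall>j\<in>J. v \<bullet> w j \<le> 0}"
proof (intro set_eqI iffI)
  fix v assume v: "v \<in> polar_cone (pos (w ` J))"
  have "w j \<in> pos (w ` J)" if "j \<in> J" for j
    using that unfolding pos_image_eq_hull[OF assms] by (simp add: hull_inc)
  then show "v \<in> {v. \<forall>j\<in>J. v \<bullet> w j \<le> 0}" using v by (auto simp: polar_cone_def)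
next
  fix v assume "v \<in> {v. \<forall>j\<in>J. v \<bullet> w j \<le> 0}"
  then show "v \<in> polar_cone (pos (w ` J))"
    unfolding polar_cone_def pos_image[OF assms]
    by (auto simp: inner_sum_right intro!: sum_nonpos mult_nonneg_nonpos)
qed

text \<open>A point outside the closed convex cone could be strictly separated from it, and the
  negative of the separating normal would violate the hypothesis on \<open>y\<close>.\<close>

lemma farkas:
  fixes w :: "'i \<Rightarrow> 'a::euclidean_space"
  assumes J: "finite J" and y: "\<And>v. (\<And>j. j \<in> J \<Longrightarrow> v \<bullet> w j \<le> 0) \<Longrightarrow> v \<bullet> y \<le> 0"
  shows "y \<in> pos (w ` J)"
proof (rule ccontr)
  assume "y \<notin> pos (w ` J)"
  moreover have cc: "convex_cone (pos (w ` J))" "closed (pos (w ` J))"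
    using J by (simp_all add: pos_image_eq_hull convex_cone_convex_cone_hull closed_convex_cone_hull)
  moreover from cc(1) have "convex (pos (w ` J))" by (simp add: convex_cone_def)
  ultimately obtain a b where ab: "a \<bullet> y < b" "\<And>x. x \<in> pos (w ` J) \<Longrightarrow> b < a \<bullet> x"
    using separating_hyperplane_closed_point[of "pos (w ` J)" y] by auto
  have "0 \<in> pos (w ` J)" using J by (simp add: pos_image_eq_hull convex_cone_hull_contains_0)
  then have "b < 0" using ab(2) by fastforce
  have "(- a) \<bullet> w j \<le> 0" if j: "j \<in> J" for j
  proof (rule ccontr)
    assume "\<not> (- a) \<bullet> w j \<le> 0"
    then have neg: "a \<bullet> w j < 0" by simp
    \<comment> \<open>The factor is positive, being a quotient of negative numbers, and it makes the
      inner product with \<open>a\<close> exactly \<open>b\<close>, against the strict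
      separation.\<close>
    have "(b / (a \<bullet> w j)) *\<^sub>R w j \<in> pos (w ` J)"
      unfolding pos_image_eq_hull[OF J] using j neg \<open>b < 0\<close>
      by (intro convex_cone_hull_mul hull_inc) (auto simp: divide_nonpos_nonpos)
    from ab(2)[OF this] show False using neg by simp
  qed
  from y[OF this] show False using ab(1) \<open>b < 0\<close> by simp
qed

text \<open>If the cone is everything, a polar vector satisfies
  \<open>v \<bullet> v \<le> 0\<close>; if only 0 is polar, the hypothesis of \<open>farkas\<close>
  holds for every \<open>y\<close>.\<close>

lemma pos_eq_UNIV_iff:
  fixes w :: "'i \<Rightarrow> 'a::euclidean_space"
  assumes J: "finite J"
  shows "pos (w ` J) = UNIV \<longleftrightarrow> (\<forall>v. (\<forall>j\<in>J. v \<bullet> w j \<le> 0) \<longrightarrow> v = 0)"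
proof
  assume P: "pos (w ` J) = UNIV"
  show "\<forall>v. (\<forall>j\<in>J. v \<bullet> w j \<le> 0) \<longrightarrow> v = 0"
    using polar_cone_pos_image[OF J, of w] unfolding P polar_cone_def
    by (auto simp: set_eq_iff) (metis inner_eq_zero_iff inner_ge_zero order_antisym)
next
  assume "\<forall>v. (\<forall>j\<in>J. v \<bullet> w j \<le> 0) \<longrightarrow> v = 0"
  then show "pos (w ` J) = UNIV" using farkas[OF J, of w] by (metis UNIV_eq_I inner_zero_left order_refl)
qed

section \<open>Orthogonal projection onto the span of the polar cone\<close>

lemma closest_point_subspace_eqI:
  fixes L :: "'a::euclidean_space set"
  assumes L: "subspace L" and y: "y \<in> L" and orth: "\<And>v. v \<in> L \<Longrightarrow> (x - y) \<bullet> v = 0"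
  shows "closest_point L x = y"
proof (rule closest_point_unique[symmetric])
  show "convex L" "closed L" using L by (auto simp: subspace_imp_convex closed_subspace)
  show "\<forall>z\<in>L. dist x y \<le> dist x z"
  proof
    fix z assume "z \<in> L"
    then have "(x - y) \<bullet> (y - z) = 0" using L y by (intro orth) (simp add: subspace_diff)
    then have "(norm ((x - y) + (y - z)))\<^sup>2 = (norm (x - y))\<^sup>2 + (norm (y - z))\<^sup>2"
      by (intro norm_add_Pythagorean) (simp add: orthogonal_def)
    then have "(norm (x - y))\<^sup>2 \<le> (norm (x - z))\<^sup>2" by simp
    then show "dist x y \<le> dist x z" by (simp add: dist_norm)
  qed
qed (fact y)

text \<open>A vector orthogonal to \<open>K\<close> is orthogonal to its span. The criterion thereby
  avoids the span, whose dimension may jump as the generators vary.\<close>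

lemma closest_point_span_mem_iff:
  fixes K :: "'a::euclidean_space set"
  shows "closest_point (span K) x \<in> K \<longleftrightarrow> (\<exists>y\<in>K. \<forall>v\<in>K. (x - y) \<bullet> v = 0)"
proof
  obtain y z where yz: "y \<in> span K" "\<And>v. v \<in> span K \<Longrightarrow> orthogonal z v" "x = y + z"
    using orthogonal_subspace_decomp_exists[of K x] by blast
  then have "closest_point (span K) x = y"
    by (intro closest_point_subspace_eqI) (auto simp: orthogonal_def)
  moreover assume "closest_point (span K) x \<in> K"
  ultimately show "\<exists>y\<in>K. \<forall>v\<in>K. (x - y) \<bullet> v = 0"
    using yz by (intro bexI[of _ y]) (auto simp: orthogonal_def span_base)
next
  assume "\<exists>y\<in>K. \<forall>v\<in>K. (x - y) \<bullet> v = 0"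
  then obtain y where y: "y \<in> K" "\<forall>v\<in>K. (x - y) \<bullet> v = 0" by blast
  have "(x - y) \<bullet> v = 0" if "v \<in> span K" for v
    using that by (induction rule: span_induct_alt) (use y in \<open>auto simp: inner_add_right\<close>)
  then have "closest_point (span K) x = y"
    using y(1) by (intro closest_point_subspace_eqI) (auto simp: span_base)
  then show "closest_point (span K) x \<in> K" using y(1) by simp
qed

text \<open>By the Farkas lemma \<open>p\<close> is orthogonal to \<open>K\<close> exactly if
  \<open>p\<close> and \<open>- p\<close> both lie in the cone of the \<open>w j\<close>. For
  \<open>p = x - y\<close> the coefficients of the two representations are \<open>a\<close> and
  \<open>b\<close>. What remains are finitely many closed conditions on \<open>w\<close>,
  \<open>x\<close>, \<open>a\<close> and \<open>b\<close>, as the measurability proof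
  requires.\<close>

lemma closest_point_span_polar_iff:
  fixes w :: "'i \<Rightarrow> 'a::euclidean_space"
  assumes J: "finite J"
  defines "K \<equiv> {v. \<forall>j\<in>J. v \<bullet> w j \<le> 0}"
  shows "closest_point (span K) x \<in> K \<longleftrightarrow>
    (\<exists>a b. (\<forall>j\<in>J. a j \<ge> 0 \<and> b j \<ge> 0 \<and> (x - (\<Sum>i\<in>J. a i *\<^sub>R w i)) \<bullet> w j \<le> 0) \<and>
      (\<Sum>i\<in>J. (a i + b i) *\<^sub>R w i) = 0)" (is "_ \<longleftrightarrow> ?R")
proof -
  have perp: "(\<forall>v\<in>K. p \<bullet> v = 0) \<longleftrightarrow> p \<in> pos (w ` J) \<and> - p \<in> pos (w ` J)" for p
  proof
    assume p: "\<forall>v\<in>K. p \<bullet> v = 0"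
    show "p \<in> pos (w ` J) \<and> - p \<in> pos (w ` J)"
      using p by (intro conjI farkas[OF J]) (auto simp: K_def inner_commute)
  next
    assume p: "p \<in> pos (w ` J) \<and> - p \<in> pos (w ` J)"
    have "v \<bullet> p \<le> 0" "v \<bullet> (- p) \<le> 0" if "v \<in> K" for v
      using that p polar_cone_pos_image[OF J, of w] unfolding K_def polar_cone_def by blast+
    then show "\<forall>v\<in>K. p \<bullet> v = 0" by (force simp: inner_commute)
  qed
  have "closest_point (span K) x \<in> K \<longleftrightarrow> (\<exists>y\<in>K. x - y \<in> pos (w ` J) \<and> - (x - y) \<in> pos (w ` J))"
    unfolding closest_point_span_mem_iff perp ..
  also have "\<dots> \<longleftrightarrow> ?R"
  proof
    assume "\<exists>y\<in>K. x - y \<in> pos (w ` J) \<and> - (x - y) \<in> pos (w ` J)"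
    then obtain y a b where y: "y \<in> K" and a: "\<forall>j\<in>J. a j \<ge> (0::real)" "x - y = (\<Sum>j\<in>J. a j *\<^sub>R w j)"
      and b: "\<forall>j\<in>J. b j \<ge> (0::real)" "- (x - y) = (\<Sum>j\<in>J. b j *\<^sub>R w j)"
      unfolding pos_image[OF J] by blast
    have "(\<Sum>i\<in>J. (a i + b i) *\<^sub>R w i) = (\<Sum>i\<in>J. a i *\<^sub>R w i) + (\<Sum>i\<in>J. b i *\<^sub>R w i)"
      by (simp add: scaleR_add_left sum.distrib)
    also have "\<dots> = 0" by (simp flip: a(2) b(2))
    finally have sum: "(\<Sum>i\<in>J. (a i + b i) *\<^sub>R w i) = 0" .
    have "x - (\<Sum>i\<in>J. a i *\<^sub>R w i) = y" by (simp flip: a(2))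
    then have "\<forall>j\<in>J. (x - (\<Sum>i\<in>J. a i *\<^sub>R w i)) \<bullet> w j \<le> 0" using y by (simp add: K_def)
    then show ?R using a(1) b(1) sum by (intro exI[of _ a] exI[of _ b]) blast
  next
    assume ?R
    then obtain a b where ab: "\<forall>j\<in>J. a j \<ge> 0 \<and> b j \<ge> 0 \<and> (x - (\<Sum>i\<in>J. a i *\<^sub>R w i)) \<bullet> w j \<le> 0"
      "(\<Sum>i\<in>J. (a i + b i) *\<^sub>R w i) = 0" by blast
    have "- (\<Sum>i\<in>J. a i *\<^sub>R w i) = (\<Sum>i\<in>J. b i *\<^sub>R w i)"
      using ab(2) by (simp add: scaleR_add_left sum.distrib add_eq_0_iff2)
    then have "- (\<Sum>i\<in>J. a i *\<^sub>R w i) \<in> pos (w ` J)"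
      unfolding pos_image[OF J] using ab(1) by blast
    moreover have "(\<Sum>i\<in>J. a i *\<^sub>R w i) \<in> pos (w ` J)"
      unfolding pos_image[OF J] using ab(1) by blast
    ultimately show "\<exists>y\<in>K. x - y \<in> pos (w ` J) \<and> - (x - y) \<in> pos (w ` J)"
      using ab(1) by (intro bexI[of _ "x - (\<Sum>i\<in>J. a i *\<^sub>R w i)"]) (simp_all add: K_def)
  qed
  finally show ?thesis .
qed

text \<open>Projection along a compact factor is a closed map.\<close>

lemma closed_compact_projection:
  fixes S :: "('x::topological_space \<times> 'y::topological_space) set"
  assumes S: "closed S" and K: "compact K"
  shows "closed {x. \<exists>y\<in>K. (x, y) \<in> S}"
proof -
  have "closed_map (prod_topology euclidean (top_of_set K)) euclidean (fst :: 'x \<times> 'y \<Rightarrow> 'x)"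
    by (rule closed_map_fst) (simp add: compact_space_subtopology K)
  moreover have "prod_topology euclidean (top_of_set K) = top_of_set ((UNIV :: 'x set) \<times> K)"
    by (simp add: prod_topology_subtopology(2))
  moreover have "closedin (top_of_set (UNIV \<times> K)) (S \<inter> UNIV \<times> K)"
    using closedin_closed_Int[OF S, of "UNIV \<times> K"] by (simp add: Int_commute)
  ultimately have "closed (fst ` (S \<inter> UNIV \<times> K))"
    by (simp add: closed_map_def)
  also have "fst ` (S \<inter> UNIV \<times> K) = {x. \<exists>y\<in>K. (x, y) \<in> S}" by force
  finally show ?thesis .
qed

text \<open>Tychonoff's theorem: the set is a product of compact intervals in the product
  topology.\<close>

lemma compact_bounded_functions: "compact {a :: 'i \<Rightarrow> real. \<forall>i. \<bar>a i\<bar> \<le> N}"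
proof -
  have "compactin (product_topology (\<lambda>_. euclideanreal) (UNIV :: 'i set)) (PiE UNIV (\<lambda>_. {-N..N}))"
    by (subst compactin_PiE) auto
  also have "PiE UNIV (\<lambda>_. {-N..N}) = {a :: 'i \<Rightarrow> real. \<forall>i. \<bar>a i\<bar> \<le> N}"
    by (simp add: PiE_def Pi_def abs_le_iff minus_le_iff conj_commute)
  finally show ?thesis by (simp add: euclidean_product_topology)
qed

subsection \<open>Measurability of the solid angle of the polar cone\<close>

lemma closed_Collect_Ball:
  "(\<And>j. j \<in> J \<Longrightarrow> closed {x. P j x}) \<Longrightarrow> closed {x. \<forall>j\<in>J. P j x}"
  using closed_INT[of J "\<lambda>j. {x. P j x}"] by (simp add: Collect_ball_eq)

text \<open>
  The underlying probability space need not be complete, so the solid angle has to be measurable on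
  the degenerate event as well, where it refers to a lower-dimensional normal distribution. By the
  Farkas lemma the relevant sets are projections of closed sets along a \<open>\<sigma>\<close>-compact space of
  coefficients, hence \<open>F\<^sub>\<sigma>\<close>.
\<close>

lemma borel_sigma_compact_projection:
  fixes S :: "('x::topological_space \<times> 'y::topological_space) set" and K :: "nat \<Rightarrow> 'y set"
  assumes "closed S" and "\<And>N. compact (K N)"
  shows "{x. \<exists>N. \<exists>y\<in>K N. (x, y) \<in> S} \<in> sets borel"
proof -
  have "{x. \<exists>N. \<exists>y\<in>K N. (x, y) \<in> S} = (\<Union>N. {x. \<exists>y\<in>K N. (x, y) \<in> S})" by blast
  also have "\<dots> \<in> sets borel"
    by (intro sets.countable_UN image_subsetI borel_closed closed_compact_projection assms)
  finally show ?thesis .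
qed

text \<open>The compact boxes bound all indices, but only coefficients on \<open>J\<close> matter;
  setting the others to 0 puts a coefficient function into one of countably many boxes.\<close>

lemma finite_truncation_bounded:
  fixes a :: "'i \<Rightarrow> real"
  assumes "finite J"
  shows "\<exists>N::nat. \<forall>i. \<bar>if i \<in> J then a i else 0\<bar> \<le> real N"
proof -
  obtain N :: nat where N: "(\<Sum>i\<in>J. \<bar>a i\<bar>) \<le> real N" using real_arch_simple by blast
  have "\<bar>a i\<bar> \<le> (\<Sum>i\<in>J. \<bar>a i\<bar>)" if "i \<in> J" for i
    using member_le_sum[of i J "\<lambda>i. \<bar>a i\<bar>"] that assms by simp
  then show ?thesis using N by (intro exI[of _ N]) (auto intro: order_trans)
qed

lemma borel_closest_point_span_polar:
  fixes J :: "'i::countable set"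
  assumes J: "finite J"
  shows "{p :: ('i \<Rightarrow> 'a::euclidean_space) \<times> 'a.
    closest_point (span {v. \<forall>j\<in>J. v \<bullet> fst p j \<le> 0}) (snd p) \<in> {v. \<forall>j\<in>J. v \<bullet> fst p j \<le> 0}} \<in> sets borel"
proof -
  \<comment> \<open>Points of \<open>S\<close> have the form \<open>((w, x), (a, b))\<close> and
    satisfy the coefficient criterion of \<open>closest_point_span_polar_iff\<close>.\<close>
  define S :: "((('i \<Rightarrow> 'a) \<times> 'a) \<times> ('i \<Rightarrow> real) \<times> ('i \<Rightarrow> real)) set" where
    "S = {q. (\<forall>j\<in>J. 0 \<le> fst (snd q) j \<and> 0 \<le> snd (snd q) j \<and>
        (snd (fst q) - (\<Sum>i\<in>J. fst (snd q) i *\<^sub>R fst (fst q) i)) \<bullet> fst (fst q) j \<le> 0) \<and>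
      (\<Sum>i\<in>J. (fst (snd q) i + snd (snd q) i) *\<^sub>R fst (fst q) i) = 0}"
  define B where "B N = {a :: 'i \<Rightarrow> real. \<forall>i. \<bar>a i\<bar> \<le> real N}" for N
  have cont: "continuous_on UNIV (\<lambda>q::((('i \<Rightarrow> 'a) \<times> 'a) \<times> ('i \<Rightarrow> real) \<times> ('i \<Rightarrow> real)). fst (fst q) i)"
    "continuous_on UNIV (\<lambda>q::((('i \<Rightarrow> 'a) \<times> 'a) \<times> ('i \<Rightarrow> real) \<times> ('i \<Rightarrow> real)). fst (snd q) i)"
    "continuous_on UNIV (\<lambda>q::((('i \<Rightarrow> 'a) \<times> 'a) \<times> ('i \<Rightarrow> real) \<times> ('i \<Rightarrow> real)). snd (snd q) i)" for i
    by (rule continuous_on_product_then_coordinatewise,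
        intro continuous_on_fst continuous_on_snd continuous_on_id)+
  have "closed S"
    unfolding S_def
    by (intro closed_Collect_conj closed_Collect_Ball closed_Collect_le closed_Collect_eq
        continuous_on_inner continuous_on_diff continuous_on_sum continuous_on_scaleR
        continuous_on_add cont continuous_on_fst continuous_on_snd continuous_on_id continuous_on_const)
  moreover have "compact (B N \<times> B N)" for N
    unfolding B_def by (intro compact_Times compact_bounded_functions)
  ultimately have "{p. \<exists>N. \<exists>y\<in>B N \<times> B N. (p, y) \<in> S} \<in> sets borel"
    by (rule borel_sigma_compact_projection)
  also have "{p. \<exists>N. \<exists>y\<in>B N \<times> B N. (p, y) \<in> S} = {p.
    closest_point (span {v. \<forall>j\<in>J. v \<bullet> fst p j \<le> 0}) (snd p) \<in> {v. \<forall>j\<in>J. v \<bullet> fst p j \<le> 0}}"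
    unfolding closest_point_span_polar_iff[OF J]
  proof (intro Collect_cong iffI)
    fix p :: "('i \<Rightarrow> 'a) \<times> 'a"
    assume "\<exists>N. \<exists>y\<in>B N \<times> B N. (p, y) \<in> S"
    then show "\<exists>a b. (\<forall>j\<in>J. a j \<ge> 0 \<and> b j \<ge> 0 \<and> (snd p - (\<Sum>i\<in>J. a i *\<^sub>R fst p i)) \<bullet> fst p j \<le> 0) \<and>
      (\<Sum>i\<in>J. (a i + b i) *\<^sub>R fst p i) = 0"
      unfolding S_def by auto
  next
    fix p :: "('i \<Rightarrow> 'a) \<times> 'a"
    assume "\<exists>a b. (\<forall>j\<in>J. a j \<ge> 0 \<and> b j \<ge> 0 \<and> (snd p - (\<Sum>i\<in>J. a i *\<^sub>R fst p i)) \<bullet> fst p j \<le> 0) \<and>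
      (\<Sum>i\<in>J. (a i + b i) *\<^sub>R fst p i) = 0"
    then obtain a b where ab: "\<forall>j\<in>J. a j \<ge> 0 \<and> b j \<ge> 0 \<and> (snd p - (\<Sum>i\<in>J. a i *\<^sub>R fst p i)) \<bullet> fst p j \<le> 0"
      "(\<Sum>i\<in>J. (a i + b i) *\<^sub>R fst p i) = 0" by blast
    define a' b' where "a' i = (if i \<in> J then a i else 0)" and "b' i = (if i \<in> J then b i else 0)" for i
    obtain N1 N2 where N: "\<forall>i. \<bar>a' i\<bar> \<le> real N1" "\<forall>i. \<bar>b' i\<bar> \<le> real N2"
      using finite_truncation_bounded[OF J, of a] finite_truncation_bounded[OF J, of b]
      unfolding a'_def b'_def by blast
    have "(a', b') \<in> B (max N1 N2) \<times> B (max N1 N2)"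
      using N unfolding B_def by (auto intro: order_trans)
    moreover have "(p, (a', b')) \<in> S"
      using ab unfolding S_def by (simp add: a'_def b'_def)
    ultimately show "\<exists>N. \<exists>y\<in>B N \<times> B N. (p, y) \<in> S" by blast
  qed
  finally show ?thesis .
qed

text \<open>Taking the polar vector of norm 1 makes this a projection of a closed set along the
  compact sphere.\<close>

lemma closed_polar_nontrivial:
  fixes J :: "'i::countable set"
  shows "closed {w :: 'i \<Rightarrow> 'a::euclidean_space. \<exists>v\<in>sphere 0 1. \<forall>j\<in>J. v \<bullet> w j \<le> 0}"
proof -
  have "closed {q :: ('i \<Rightarrow> 'a) \<times> 'a. \<forall>j\<in>J. snd q \<bullet> fst q j \<le> 0}"
    by (intro closed_Collect_Ball closed_Collect_le continuous_on_inner continuous_on_const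
        continuous_on_snd[OF continuous_on_id]
        continuous_on_product_then_coordinatewise[OF continuous_on_fst[OF continuous_on_id]])
  from closed_compact_projection[OF this compact_sphere[of 0 1]] show ?thesis by simp
qed

lemma polar_nontrivial_iff:
  fixes w :: "'i \<Rightarrow> 'a::euclidean_space"
  assumes "finite J"
  shows "pos (w ` J) \<noteq> UNIV \<longleftrightarrow> (\<exists>v\<in>sphere 0 1. \<forall>j\<in>J. v \<bullet> w j \<le> 0)"
proof
  assume "pos (w ` J) \<noteq> UNIV"
  then obtain v where v: "\<forall>j\<in>J. v \<bullet> w j \<le> 0" "v \<noteq> 0" using pos_eq_UNIV_iff[OF assms] by blast
  then show "\<exists>v\<in>sphere 0 1. \<forall>j\<in>J. v \<bullet> w j \<le> 0"
    by (intro bexI[of _ "sgn v"]) (auto simp: sgn_div_norm mult_nonneg_nonpos)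
next
  assume "\<exists>v\<in>sphere 0 1. \<forall>j\<in>J. v \<bullet> w j \<le> 0"
  then obtain v where v: "norm v = 1" "\<forall>j\<in>J. v \<bullet> w j \<le> 0" by auto
  then have "v \<noteq> 0" by auto
  then show "pos (w ` J) \<noteq> UNIV" using v(2) pos_eq_UNIV_iff[OF assms] by blast
qed

section \<open>The normal measure of the polar cone\<close>

lemma sets_std_normal[measurable_cong, simp]: "sets std_normal = sets borel"
  by (simp add: std_normal_def)

lemma space_std_normal[simp]: "space std_normal = UNIV"
  by (simp add: std_normal_def)

text \<open>The density factors over the coordinates into one-dimensional standard normal densities,
  each of integral 1.\<close>

lemma prob_space_std_normal: "prob_space (std_normal :: 'a::euclidean_space measure)"
proof
  have eq: "(2 * pi) powr (- real DIM('a) / 2) * exp (- (norm x)\<^sup>2 / 2) =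
    (\<Prod>b\<in>Basis. std_normal_density (x \<bullet> b))" for x :: 'a
  proof -
    have "(\<Prod>b\<in>Basis. std_normal_density (x \<bullet> b)) =
      (\<Prod>b\<in>(Basis::'a set). 1 / sqrt (2 * pi)) * (\<Prod>b\<in>Basis. exp (- (x \<bullet> b)\<^sup>2 / 2))"
      by (simp add: std_normal_density_def prod_dividef power_divide)
    also have "(\<Prod>b\<in>(Basis::'a set). 1 / sqrt (2 * pi)) = (2 * pi) powr (- real DIM('a) / 2)"
      by (simp add: powr_half_sqrt[symmetric] powr_minus_divide[symmetric] powr_power)
    also have "(\<Prod>b\<in>Basis. exp (- (x \<bullet> b)\<^sup>2 / 2)) = exp (\<Sum>b\<in>Basis. - (x \<bullet> b)\<^sup>2 / 2)"
      by (simp add: exp_sum)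
    also have "(\<Sum>b\<in>Basis. - (x \<bullet> b)\<^sup>2 / 2) = - (norm x)\<^sup>2 / 2"
    proof -
      have "(norm x)\<^sup>2 = (\<Sum>b\<in>Basis. (x \<bullet> b)\<^sup>2)"
        unfolding power2_norm_eq_inner euclidean_inner[of x x] by (simp add: power2_eq_square)
      then show ?thesis by (simp only: sum_negf flip: sum_divide_distrib)
    qed
    finally show ?thesis by simp
  qed
  have "emeasure (std_normal :: 'a measure) (space std_normal) =
    (\<integral>\<^sup>+x. (\<Prod>b\<in>Basis. ennreal (std_normal_density ((x::'a) \<bullet> b))) \<partial>lborel)"
    unfolding std_normal_def eq by (subst emeasure_density) (auto simp: prod_ennreal)
  also have "\<dots> = (\<Prod>b\<in>(Basis::'a set). \<integral>\<^sup>+x. ennreal (std_normal_density x) \<partial>lborel)"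
    by (rule nn_integral_lborel_prod) auto
  also have "(\<integral>\<^sup>+x. ennreal (std_normal_density x) \<partial>lborel) = 1"
    using prob_space.emeasure_space_1[OF prob_space_normal_density[of 1 0]]
    by (simp add: emeasure_density)
  finally show "emeasure (std_normal :: 'a measure) (space std_normal) = 1" by simp
qed

lemma closed_polar_halfspaces:
  fixes w :: "'i \<Rightarrow> 'a::euclidean_space"
  shows "closed {v. \<forall>j\<in>J. v \<bullet> w j \<le> 0}"
  by (intro closed_Collect_Ball closed_Collect_le continuous_intros)

lemma solid_angle_polar:
  fixes w :: "'i \<Rightarrow> 'a::euclidean_space"
  assumes "finite J"
  defines "K \<equiv> {v. \<forall>j\<in>J. v \<bullet> w j \<le> 0}"
  shows "solid_angle (polar_cone (pos (w ` J))) = measure std_normal {x. closest_point (span K) x \<in> K}"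
proof -
  have "span K \<noteq> {}" using span_zero[of K] by auto
  then have "continuous_on UNIV (closest_point (span K))"
    by (intro continuous_on_closest_point) (auto simp: subspace_imp_convex closed_subspace)
  then have [measurable]: "closest_point (span K) \<in> borel_measurable borel"
    by (rule borel_measurable_continuous_onI)
  have "closed K" unfolding K_def by (rule closed_polar_halfspaces)
  then have [measurable]: "K \<in> sets borel" by (rule borel_closed)
  show ?thesis
    unfolding solid_angle_def std_normal_on_def polar_cone_pos_image[OF assms(1)] K_def[symmetric]
    by (subst measure_distr) (auto simp: vimage_def)
qed

lemma measurable_solid_angle_polar:
  fixes J :: "'i::countable set"
  assumes J: "finite J"
  shows "(\<lambda>w :: 'i \<Rightarrow> 'a::euclidean_space.
    solid_angle (polar_cone (pos (w ` J))) * indicator {w. pos (w ` J) \<noteq> UNIV} w) \<in> borel_measurable borel"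
proof -
  interpret N: prob_space "std_normal :: 'a measure" by (rule prob_space_std_normal)
  define E where "E = {p :: ('i \<Rightarrow> 'a) \<times> 'a.
    closest_point (span {v. \<forall>j\<in>J. v \<bullet> fst p j \<le> 0}) (snd p) \<in> {v. \<forall>j\<in>J. v \<bullet> fst p j \<le> 0}}"
  have "E \<in> sets borel" unfolding E_def by (rule borel_closest_point_span_polar[OF J])
  \<comment> \<open>The index type is countable, so the function space is second countable and Borel
    sets of the product belong to the product sigma-algebra.\<close>
  then have "E \<in> sets (borel \<Otimes>\<^sub>M borel)" by (subst borel_prod)
  also have "sets (borel \<Otimes>\<^sub>M borel) = sets (borel \<Otimes>\<^sub>M (std_normal :: 'a measure))"
    by (intro sets_pair_measure_cong) auto
  finally have "E \<in> sets (borel \<Otimes>\<^sub>M (std_normal :: 'a measure))" .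
  then have "(\<lambda>w. emeasure std_normal (Pair w -` E)) \<in> borel_measurable borel"
    by (rule N.measurable_emeasure_Pair)
  then have [measurable]: "(\<lambda>w. measure std_normal (Pair w -` E)) \<in> borel_measurable borel"
    unfolding measure_def by measurable
  have "solid_angle (polar_cone (pos (w ` J))) = measure std_normal (Pair w -` E)" for w :: "'i \<Rightarrow> 'a"
    unfolding solid_angle_polar[OF J] E_def vimage_def by simp
  moreover have [measurable]: "{w :: 'i \<Rightarrow> 'a. pos (w ` J) \<noteq> UNIV} \<in> sets borel"
    unfolding polar_nontrivial_iff[OF J] by (intro borel_closed closed_polar_nontrivial)
  ultimately show ?thesis by simp
qed

text \<open>If the cone is the whole space, its polar cone is the null set \<open>{0}\<close>.
  Otherwise Gordan's alternative applies: either the inequalities have a strict solution, and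
  \<open>K\<close> contains a nonempty open set, or 0 is a convex combination of the
  \<open>w j\<close>, which \<open>generic\<close> excludes in the presence of a nonzero polar
  vector.\<close>

lemma solid_angle_polar_generic:
  fixes w :: "'i \<Rightarrow> 'a::euclidean_space"
  assumes J: "finite J"
    and generic: "\<And>j F. j \<in> J \<Longrightarrow> F \<subseteq> J - {j} \<Longrightarrow> span (w ` F) \<noteq> UNIV \<Longrightarrow> w j \<notin> span (w ` F)"
  shows "solid_angle (polar_cone (pos (w ` J))) * indicator {w. pos (w ` J) \<noteq> UNIV} w =
    measure std_normal {v. \<forall>j\<in>J. v \<bullet> w j \<le> 0}"
proof (cases "pos (w ` J) = UNIV")
  case True
  then have K: "{v. \<forall>j\<in>J. v \<bullet> w j \<le> 0} = {0}" using pos_eq_UNIV_iff[OF J, of w] by auto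
  have "AE x in lborel. (x::'a) \<notin> {0}" by (intro AE_not_in) (simp add: null_setsI)
  then have "emeasure (std_normal :: 'a measure) {0} = 0"
    unfolding std_normal_def by (subst emeasure_density) (auto simp: nn_integral_0_iff_AE elim!: eventually_mono)
  then show ?thesis using True by (simp add: K measure_def)
next
  case False
  define K where "K = {v. \<forall>j\<in>J. v \<bullet> w j \<le> 0}"
  obtain v0 where v0: "v0 \<in> K" "v0 \<noteq> 0" using False pos_eq_UNIV_iff[OF J, of w] by (auto simp: K_def)
  have "\<exists>v. \<forall>j\<in>J. v \<bullet> w j < 0"
  proof (rule ccontr)
    assume no: "\<nexists>v. \<forall>j\<in>J. v \<bullet> w j < 0"
    have "0 \<in> convex hull (w ` J)"
    proof (rule ccontr)
      assume "0 \<notin> convex hull (w ` J)"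
      moreover have "closed (convex hull (w ` J))"
        using J by (intro compact_imp_closed finite_imp_compact_convex_hull) auto
      ultimately obtain a b where ab: "0 < b" "\<And>x. x \<in> convex hull (w ` J) \<Longrightarrow> a \<bullet> x > b"
        using separating_hyperplane_closed_0[of "convex hull (w ` J)"] by auto
      have "(- a) \<bullet> w j < 0" if "j \<in> J" for j
        using ab(1) ab(2)[of "w j"] that by (simp add: hull_inc)
      with no show False by blast
    qed
    then obtain c where c: "\<forall>x\<in>w ` J. 0 \<le> c x" "sum c (w ` J) = 1" "(\<Sum>x\<in>w ` J. c x *\<^sub>R x) = 0"
      using J by (auto simp: convex_hull_finite)
    obtain x0 where x0: "x0 \<in> w ` J" "c x0 \<noteq> 0"
      using c(2) by (metis sum.neutral zero_neq_one)
    then obtain j where j: "j \<in> J" "w j = x0" by blast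
    \<comment> \<open>\<open>F\<close> is selected by vectors, because the convex coefficients
      \<open>c\<close> belong to vectors. It omits every index whose vector equals
      \<open>x0\<close>, hence also \<open>j\<close>.\<close>
    define F where "F = {i\<in>J. c (w i) \<noteq> 0 \<and> w i \<noteq> x0}"
    \<comment> \<open>The terms \<open>c x * (v0 \<bullet> x)\<close> are at most 0 and add up to 0,
      so each vanishes. Thus \<open>v0\<close> is normal to the span over \<open>F\<close>, which is
      therefore proper.\<close>
    have orth: "v0 \<bullet> x = 0" if x: "x \<in> w ` J" "c x \<noteq> 0" for x
    proof -
      have "(\<Sum>x\<in>w ` J. - (c x * (v0 \<bullet> x))) = - (v0 \<bullet> (\<Sum>x\<in>w ` J. c x *\<^sub>R x))"
        by (simp add: inner_sum_right sum_negf)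
      also have "\<dots> = 0" unfolding c(3) by simp
      finally have s: "(\<Sum>x\<in>w ` J. - (c x * (v0 \<bullet> x))) = 0" .
      have "\<forall>x\<in>w ` J. - (c x * (v0 \<bullet> x)) = 0"
        using s J c(1) v0(1)
        by (subst (asm) sum_nonneg_eq_0_iff) (auto simp: K_def intro!: mult_nonneg_nonpos)
      then show ?thesis using x by auto
    qed
    have "span (w ` F) \<noteq> UNIV"
    proof
      assume "span (w ` F) = UNIV"
      moreover have "v0 \<bullet> y = 0" if "y \<in> span (w ` F)" for y
        using that by (induction rule: span_induct_alt) (auto simp: F_def inner_add_right orth)
      ultimately show False using v0(2) by (metis UNIV_I inner_eq_zero_iff)
    qed
    moreover have "w j \<in> span (w ` F)"
    proof -
      have "c x0 *\<^sub>R x0 + (\<Sum>x\<in>w ` J - {x0}. c x *\<^sub>R x) = 0"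
        using c(3) J x0(1) by (simp add: sum.remove)
      then have "c x0 *\<^sub>R x0 = - (\<Sum>x\<in>w ` J - {x0}. c x *\<^sub>R x)"
        by (simp only: eq_neg_iff_add_eq_0)
      then have "(1 / c x0) *\<^sub>R (c x0 *\<^sub>R x0) = (1 / c x0) *\<^sub>R (- (\<Sum>x\<in>w ` J - {x0}. c x *\<^sub>R x))"
        by (rule arg_cong)
      then have "x0 = (1 / c x0) *\<^sub>R (- (\<Sum>x\<in>w ` J - {x0}. c x *\<^sub>R x))"
        using x0(2) by simp
      also have "\<dots> \<in> span (w ` F)"
      proof (rule span_scale, rule span_neg, rule span_sum)
        fix x assume "x \<in> w ` J - {x0}"
        then show "c x *\<^sub>R x \<in> span (w ` F)"
          by (cases "c x = 0") (auto simp: F_def span_zero intro!: span_scale intro: span_base)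
      qed
      finally show ?thesis using j by simp
    qed
    moreover have "F \<subseteq> J - {j}" using j by (auto simp: F_def)
    ultimately show False using generic[OF j(1)] by blast
  qed
  then obtain v where v: "\<forall>j\<in>J. v \<bullet> w j < 0" by blast
  \<comment> \<open>\<open>U\<close> is open and contains \<open>v\<close>, so its affine hull is
    already the whole space, and the projection onto the span of \<open>K\<close> is the
    identity.\<close>
  define U where "U = (\<Inter>j\<in>J. {x. x \<bullet> w j < 0})"
  have "open U" unfolding U_def using J by (intro open_INT ballI open_Collect_less continuous_intros) auto
  moreover have "v \<in> U" using v by (auto simp: U_def)
  ultimately have "affine hull U = UNIV" by (intro affine_hull_open) auto
  then have "span U = UNIV" using affine_hull_subset_span[of U] by auto
  moreover have "U \<subseteq> K" by (auto simp: U_def K_def less_imp_le)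
  ultimately have "span K = UNIV" by (metis span_mono top.extremum_uniqueI)
  then have "{x. closest_point (span K) x \<in> K} = K" by (simp add: closest_point_self)
  then show ?thesis using False solid_angle_polar[OF J, of w] by (simp add: K_def)
qed

subsection \<open>General position\<close>

definition beta_density :: "real \<Rightarrow> real \<Rightarrow> real" where
  "beta_density \<gamma> s = c_beta \<gamma> * ((1 - s\<^sup>2) powr \<gamma> * indicator {-1..1} s)"

lemma beta_density_measurable[measurable]: "beta_density \<gamma> \<in> borel_measurable borel"
  unfolding beta_density_def[abs_def] by measurable

text \<open>The projection to the unit vector \<open>sgn v\<close> has a density, on the sphere as
  well, so it does not charge the single value \<open>t / norm v\<close>.\<close>

lemma beta_distr_hyperplane_null:
  fixes v :: "'a::euclidean_space"
  assumes "prob_space (beta_distr \<beta> :: 'a measure)" "\<beta> \<ge> -1" "DIM('a) \<ge> 2 \<or> \<beta> \<noteq> -1" "v \<noteq> 0"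
  shows "AE z in beta_distr \<beta>. z \<bullet> v \<noteq> t"
proof -
  have "norm (sgn v) = 1" using \<open>v \<noteq> 0\<close> by (simp add: norm_sgn)
  note marg = beta_distr_marginal[OF assms(1-3) this]
  have "AE s in lborel. s \<noteq> t / norm v"
    using AE_not_in[of "{t / norm v}" lborel] by (simp add: null_setsI)
  then have "AE s in distr (beta_distr \<beta>) borel (\<lambda>z::'a. z \<bullet> sgn v). s \<noteq> t / norm v"
    unfolding marg by (subst AE_density) (auto elim: eventually_mono)
  then have "AE z in beta_distr \<beta>. (z::'a) \<bullet> sgn v \<noteq> t / norm v"
    by (subst (asm) AE_distr_iff) auto
  then show ?thesis
    using \<open>v \<noteq> 0\<close> by (elim eventually_mono) (auto simp: sgn_div_norm divide_inverse mult.commute)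
qed

lemma span_image_finite:
  fixes w :: "'i \<Rightarrow> 'a::real_vector"
  assumes "finite F"
  shows "span (w ` F) = {\<Sum>j\<in>F. b j *\<^sub>R w j | b. True}"
proof (intro set_eqI iffI)
  fix y assume "y \<in> span (w ` F)"
  then obtain c where y: "y = (\<Sum>x\<in>w ` F. c x *\<^sub>R x)"
    using assms by (auto simp: span_finite)
  obtain I where I: "I \<subseteq> F" "inj_on w I" "w ` F = w ` I"
    using subset_image_inj[of "w ` F" w F] by auto
  have "y = (\<Sum>i\<in>I. c (w i) *\<^sub>R w i)"
    unfolding y I(3) using I(2) by (simp add: sum.reindex)
  also have "\<dots> = (\<Sum>j\<in>F. (if j \<in> I then c (w j) else 0) *\<^sub>R w j)"
    using I(1) assms by (intro sum.mono_neutral_cong_left) auto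
  finally show "y \<in> {\<Sum>j\<in>F. b j *\<^sub>R w j | b. True}"
    by (intro CollectI exI[of _ "\<lambda>j. if j \<in> I then c (w j) else 0"]) simp
next
  fix y assume "y \<in> {\<Sum>j\<in>F. b j *\<^sub>R w j | b. True}"
  then show "y \<in> span (w ` F)" by (auto intro!: span_sum intro: span_scale span_base)
qed

text \<open>A unit normal witnesses that the span is proper, and coefficients witness that it
  contains \<open>w j\<close>. Both range over a sigma-compact set and the conditions on them are
  closed.\<close>

lemma borel_degenerate:
  fixes F :: "'i::countable set"
  assumes F: "finite F"
  shows "{w :: 'i \<Rightarrow> 'a::euclidean_space. span (w ` F) \<noteq> UNIV \<and> w j \<in> span (w ` F)} \<in> sets borel"
proof -
  define S :: "(('i \<Rightarrow> 'a) \<times> 'a \<times> ('i \<Rightarrow> real)) set" where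
    "S = {q. (\<forall>i\<in>F. fst (snd q) \<bullet> fst q i = 0) \<and> fst q j = (\<Sum>i\<in>F. snd (snd q) i *\<^sub>R fst q i)}"
  define K :: "nat \<Rightarrow> ('a \<times> ('i \<Rightarrow> real)) set" where
    "K N = sphere 0 1 \<times> {a. \<forall>i. \<bar>a i\<bar> \<le> real N}" for N
  have cont: "continuous_on UNIV (\<lambda>q::(('i \<Rightarrow> 'a) \<times> 'a \<times> ('i \<Rightarrow> real)). fst q i)"
    "continuous_on UNIV (\<lambda>q::(('i \<Rightarrow> 'a) \<times> 'a \<times> ('i \<Rightarrow> real)). snd (snd q) i)" for i
    by (rule continuous_on_product_then_coordinatewise,
        intro continuous_on_fst continuous_on_snd continuous_on_id)+
  have "closed S"
    unfolding S_def
    by (intro closed_Collect_conj closed_Collect_Ball closed_Collect_eq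
        continuous_on_inner continuous_on_sum continuous_on_scaleR
        cont continuous_on_fst continuous_on_snd continuous_on_id continuous_on_const)
  moreover have "compact (K N)" for N
    unfolding K_def by (intro compact_Times compact_bounded_functions compact_sphere)
  ultimately have "{w. \<exists>N. \<exists>y\<in>K N. (w, y) \<in> S} \<in> sets borel"
    by (rule borel_sigma_compact_projection)
  also have "{w. \<exists>N. \<exists>y\<in>K N. (w, y) \<in> S} = {w. span (w ` F) \<noteq> UNIV \<and> w j \<in> span (w ` F)}"
  proof (intro Collect_cong iffI)
    fix w :: "'i \<Rightarrow> 'a" assume "\<exists>N. \<exists>y\<in>K N. (w, y) \<in> S"
    then obtain v b where v: "norm v = 1" "\<forall>i\<in>F. v \<bullet> w i = 0" and b: "w j = (\<Sum>i\<in>F. b i *\<^sub>R w i)"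
      unfolding K_def S_def by auto
    have "v \<bullet> y = 0" if "y \<in> span (w ` F)" for y
      using that v(2) by (induction rule: span_induct_alt) (auto simp: inner_add_right)
    then have "v \<notin> span (w ` F)" using v(1) by (metis inner_eq_zero_iff norm_zero zero_neq_one)
    then show "span (w ` F) \<noteq> UNIV \<and> w j \<in> span (w ` F)"
      using b span_image_finite[OF F, of w] by auto
  next
    fix w :: "'i \<Rightarrow> 'a" assume a: "span (w ` F) \<noteq> UNIV \<and> w j \<in> span (w ` F)"
    then have "span (w ` F) \<subset> UNIV" by blast
    then obtain v where v: "v \<noteq> 0" "\<And>y. y \<in> span (w ` F) \<Longrightarrow> orthogonal v y"
      using orthogonal_to_subspace_exists_gen[of "w ` F" UNIV] by auto
    obtain b where b: "w j = (\<Sum>i\<in>F. b i *\<^sub>R w i)" using a span_image_finite[OF F, of w] by auto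
    obtain N :: nat where N: "\<forall>i. \<bar>if i \<in> F then b i else 0\<bar> \<le> real N"
      using finite_truncation_bounded[OF F] by blast
    have "(sgn v, \<lambda>i. if i \<in> F then b i else 0) \<in> K N"
      using N v(1) by (simp add: K_def norm_sgn)
    moreover have "(w, (sgn v, \<lambda>i. if i \<in> F then b i else 0)) \<in> S"
    proof -
      have "sgn v \<bullet> w i = 0" if "i \<in> F" for i
        using v(2)[of "w i"] that by (simp add: sgn_div_norm orthogonal_def span_base)
      then show ?thesis using b by (simp add: S_def)
    qed
    ultimately show "\<exists>N. \<exists>y\<in>K N. (w, y) \<in> S" by blast
  qed
  finally show ?thesis .
qed

text \<open>The default 0 outside \<open>{1..n}\<close> makes this a map into the full function
  space, whose Borel sets are used throughout; index 0 stands for \<open>Z\<close>.\<close>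

definition differences :: "nat \<Rightarrow> (nat \<Rightarrow> 'a::real_vector) \<Rightarrow> nat \<Rightarrow> 'a" where
  "differences n x j = (if j \<in> {1..n} then x j - x 0 else 0)"

lemma measurable_differences[measurable]:
  fixes \<mu> :: "nat \<Rightarrow> 'a::euclidean_space measure"
  assumes "\<And>i. sets (\<mu> i) = sets borel"
  shows "differences n \<in> borel_measurable (PiM {0..n} \<mu>)"
proof (rule measurable_coordinatewise_then_product)
  fix j
  have "(\<lambda>x. x i) \<in> borel_measurable (PiM {0..n} \<mu>)" if "i \<in> {0..n}" for i
    using measurable_component_singleton[OF that, of \<mu>] by (simp add: measurable_cong_sets[OF refl assms])
  then show "(\<lambda>x. differences n x j) \<in> borel_measurable (PiM {0..n} \<mu>)"
    unfolding differences_def by (cases "j \<in> {1..n}") auto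
qed

text \<open>The coordinate \<open>j\<close> is integrated first. Since \<open>j\<close> is neither 0
  nor in \<open>F\<close>, the span over \<open>F\<close> stays fixed while \<open>z\<close> varies,
  and the bad event forces \<open>z\<close> into a fixed hyperplane through \<open>x 0\<close>,
  which is null for \<open>\<mu> j\<close>.\<close>

lemma AE_differences_nondegenerate:
  fixes \<mu> :: "nat \<Rightarrow> 'a::euclidean_space measure"
  assumes prob: "\<And>i. prob_space (\<mu> i)" and sets: "\<And>i. sets (\<mu> i) = sets borel"
    and null: "\<And>v t. v \<noteq> 0 \<Longrightarrow> AE z in \<mu> j. z \<bullet> v \<noteq> t"
    and j: "j \<in> {1..n}" and F: "F \<subseteq> {1..n} - {j}"
  shows "AE x in PiM {0..n} \<mu>. span (differences n x ` F) \<noteq> UNIV \<longrightarrow>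
    differences n x j \<notin> span (differences n x ` F)"
proof -
  interpret product_sigma_finite \<mu>
    using prob by (simp add: product_sigma_finite_def prob_space_imp_sigma_finite)
  define B where "B = {w :: nat \<Rightarrow> 'a. span (w ` F) \<noteq> UNIV \<and> w j \<in> span (w ` F)}"
  have finF: "finite F" using F finite_subset by blast
  have B[measurable]: "B \<in> sets borel" unfolding B_def by (rule borel_degenerate[OF finF])
  note measurable_differences[OF sets, measurable]
  define I where "I = {0..n} - {j}"
  have I: "insert j I = {0..n}" "finite I" "j \<notin> I" using j by (auto simp: I_def)
  have slice: "(\<integral>\<^sup>+z. indicator B (differences n (x(j := z))) \<partial>\<mu> j) = 0" for x
  proof -
    let ?L = "span ((\<lambda>i. x i - x 0) ` F)"
    have F_eq: "differences n (x(j := z)) ` F = (\<lambda>i. x i - x 0) ` F" for z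
      using F j by (intro image_cong) (auto simp: differences_def)
    have j_eq: "differences n (x(j := z)) j = z - x 0" for z
      using j by (auto simp: differences_def)
    have "AE z in \<mu> j. differences n (x(j := z)) \<notin> B"
    proof (cases "?L = UNIV")
      case True
      then show ?thesis by (simp add: B_def F_eq)
    next
      case False
      then have "?L \<subset> UNIV" by blast
      then obtain v where v: "v \<noteq> 0" "\<And>y. y \<in> ?L \<Longrightarrow> orthogonal v y"
        using orthogonal_to_subspace_exists_gen[of "(\<lambda>i. x i - x 0) ` F" UNIV] by auto
      from null[OF v(1), of "x 0 \<bullet> v"] show ?thesis
      proof (rule eventually_mono)
        fix z assume "z \<bullet> v \<noteq> x 0 \<bullet> v"
        then have "\<not> orthogonal v (z - x 0)"
          by (simp add: orthogonal_def inner_diff_right inner_commute)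
        then show "differences n (x(j := z)) \<notin> B" using v(2) by (auto simp: B_def F_eq j_eq)
      qed
    qed
    then have "(\<integral>\<^sup>+z. indicator B (differences n (x(j := z))) \<partial>\<mu> j) = (\<integral>\<^sup>+z. 0 \<partial>\<mu> j)"
      by (intro nn_integral_cong_AE) (auto elim!: eventually_mono)
    then show ?thesis by simp
  qed
  have "(\<integral>\<^sup>+x. indicator B (differences n x) \<partial>PiM (insert j I) \<mu>) =
    (\<integral>\<^sup>+x. \<integral>\<^sup>+z. indicator B (differences n (x(j := z))) \<partial>\<mu> j \<partial>PiM I \<mu>)"
    by (rule product_nn_integral_insert[OF I(2,3)]) (unfold I(1), measurable)
  then have "(\<integral>\<^sup>+x. indicator B (differences n x) \<partial>PiM {0..n} \<mu>) = 0"
    unfolding slice I(1) by simp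
  then have "AE x in PiM {0..n} \<mu>. indicator B (differences n x) = (0::ennreal)"
    by (subst (asm) nn_integral_0_iff_AE) auto
  then show ?thesis by (elim eventually_mono) (auto simp: B_def indicator_def split: if_splits)
qed

subsection \<open>The expected solid angle\<close>

text \<open>By independence the joint law is a product measure. Fixing coordinate 0 at
  \<open>t\<close> turns the event into a box, whose measure is the product of the distribution
  functions at \<open>t\<close>.\<close>

lemma (in prob_space) emeasure_all_le_first:
  fixes Y :: "nat \<Rightarrow> 'a \<Rightarrow> real"
  assumes rv[measurable]: "\<And>i. Y i \<in> borel_measurable M"
    and indep: "indep_vars (\<lambda>_. borel) Y {0..n}"
  shows "emeasure M {\<omega>\<in>space M. \<forall>j\<in>{1..n}. Y j \<omega> \<le> Y 0 \<omega>} =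
    (\<integral>\<^sup>+t. (\<Prod>j=1..n. emeasure (distr M borel (Y j)) {..t}) \<partial>distr M borel (Y 0))"
proof -
  define \<nu> where "\<nu> i = distr M borel (Y i)" for i
  have prob: "prob_space (\<nu> i)" for i unfolding \<nu>_def by (rule prob_space_distr) simp
  have sets[measurable_cong]: "sets (\<nu> i) = sets borel" and space: "space (\<nu> i) = UNIV" for i
    by (auto simp: \<nu>_def)
  interpret P: product_sigma_finite \<nu>
    using prob by (simp add: product_sigma_finite_def prob_space_imp_sigma_finite)
  let ?Y = "\<lambda>\<omega>. \<lambda>i\<in>{0..n}. Y i \<omega>"
  have joint: "distr M (PiM {0..n} (\<lambda>_. borel)) ?Y = PiM {0..n} \<nu>"
    using indep unfolding \<nu>_def by (subst (asm) indep_vars_iff_distr_eq_PiM) auto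
  have setsP: "sets (PiM {0..n} \<nu>) = sets (PiM {0..n} (\<lambda>_. borel :: real measure))"
    by (intro sets_PiM_cong) (auto simp: sets)
  let ?A = "{y \<in> space (PiM {0..n} (\<lambda>_. borel :: real measure)). \<forall>j\<in>{1..n}. y j \<le> y 0}"
  have A: "?A \<in> sets (PiM {0..n} (\<lambda>_. borel))"
    by (intro sets.sets_Collect_finite_All borel_measurable_le measurable_component_singleton) auto
  have ins: "insert 0 {1..n} = {0..n}" by auto
  have "emeasure M {\<omega>\<in>space M. \<forall>j\<in>{1..n}. Y j \<omega> \<le> Y 0 \<omega>} = emeasure M (?Y -` ?A \<inter> space M)"
    by (intro arg_cong[where f="emeasure M"]) (auto simp: space_PiM PiE_def)
  also have "\<dots> = emeasure (distr M (PiM {0..n} (\<lambda>_. borel)) ?Y) ?A"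
    by (rule emeasure_distr[symmetric]) (use A in auto)
  also have "\<dots> = (\<integral>\<^sup>+y. indicator ?A y \<partial>PiM {0..n} \<nu>)"
    unfolding joint using A by (simp add: setsP)
  also have "\<dots> = (\<integral>\<^sup>+t. \<integral>\<^sup>+y. indicator ?A (y(0 := t)) \<partial>PiM {1..n} \<nu> \<partial>\<nu> 0)"
  proof -
    have "indicator ?A \<in> borel_measurable (PiM (insert 0 {1..n}) \<nu>)"
      unfolding ins using A by (intro borel_measurable_indicator) (simp only: setsP)
    from P.product_nn_integral_insert_rev[OF _ _ this] show ?thesis by (simp only: ins) simp
  qed
  also have "\<dots> = (\<integral>\<^sup>+t. (\<Prod>j=1..n. emeasure (\<nu> j) {..t}) \<partial>\<nu> 0)"
  proof (rule nn_integral_cong)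
    fix t
    have "(\<integral>\<^sup>+y. indicator ?A (y(0 := t)) \<partial>PiM {1..n} \<nu>) =
      (\<integral>\<^sup>+y. indicator (PiE {1..n} (\<lambda>_. {..t})) y \<partial>PiM {1..n} \<nu>)"
    proof (rule nn_integral_cong)
      fix y assume "y \<in> space (PiM {1..n} \<nu>)"
      then have y: "y \<in> extensional {1..n}" by (auto simp: space_PiM PiE_def)
      then have "y(0 := t) \<in> space (PiM {0..n} (\<lambda>_. borel :: real measure))"
        by (auto simp: space_PiM PiE_def extensional_def)
      then have "y(0 := t) \<in> ?A \<longleftrightarrow> y \<in> PiE {1..n} (\<lambda>_. {..t})"
        using y by (auto simp: PiE_def)
      then show "indicator ?A (y(0 := t)) = (indicator (PiE {1..n} (\<lambda>_. {..t})) y :: ennreal)"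
        by (simp add: indicator_def)
    qed
    also have "\<dots> = emeasure (PiM {1..n} \<nu>) (PiE {1..n} (\<lambda>_. {..t}))"
      by (intro nn_integral_indicator sets_PiM_I_finite) (auto simp: sets)
    also have "\<dots> = (\<Prod>j=1..n. emeasure (\<nu> j) {..t})"
      by (intro P.emeasure_PiM) (auto simp: sets)
    finally show "(\<integral>\<^sup>+y. indicator ?A (y(0 := t)) \<partial>PiM {1..n} \<nu>) = (\<Prod>j=1..n. emeasure (\<nu> j) {..t})" .
  qed
  finally show ?thesis by (simp add: \<nu>_def)
qed

lemma beta_density_nonneg: "\<gamma> > -1 \<Longrightarrow> beta_density \<gamma> s \<ge> 0"
  using c_beta_pos[of \<gamma>] by (simp add: beta_density_def)

text \<open>The density vanishes below -1, so the half-line may replace the interval. The bound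
  \<open>t \<le> 1\<close> matters, since the integrand on the left is not cut off above 1.\<close>

lemma beta_distribution_function:
  assumes \<gamma>: "\<gamma> > -1" and "t \<le> 1"
  shows "(LBINT s:{-1..t}. c_beta \<gamma> * (1 - s\<^sup>2) powr \<gamma>) =
    measure (density lborel (\<lambda>s. ennreal (beta_density \<gamma> s))) {..t}"
proof -
  have "(LBINT s:{-1..t}. c_beta \<gamma> * (1 - s\<^sup>2) powr \<gamma>) = (\<integral>s. beta_density \<gamma> s * indicator {..t} s \<partial>lborel)"
    unfolding set_lebesgue_integral_def using \<open>t \<le> 1\<close>
    by (intro Bochner_Integration.integral_cong) (auto simp: beta_density_def split: split_indicator)
  also have "\<dots> = enn2real (\<integral>\<^sup>+s. ennreal (beta_density \<gamma> s * indicator {..t} s) \<partial>lborel)"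
    using beta_density_nonneg[OF \<gamma>] by (intro integral_eq_nn_integral) auto
  also have "(\<integral>\<^sup>+s. ennreal (beta_density \<gamma> s * indicator {..t} s) \<partial>lborel) =
    emeasure (density lborel (\<lambda>s. ennreal (beta_density \<gamma> s))) {..t}"
    by (subst emeasure_density) (auto intro!: nn_integral_cong split: split_indicator)
  finally show ?thesis by (simp add: measure_def)
qed

theorem theorem3p9:
  fixes M :: "'w measure"
    and n :: nat
    and \<beta> :: real and \<beta>s :: "nat \<Rightarrow> real"
    and Z :: "'w \<Rightarrow> 'a::euclidean_space" and Zs :: "nat \<Rightarrow> 'w \<Rightarrow> 'a"
    and C :: "'w \<Rightarrow> 'a set"
  assumes "prob_space M"
    and "n \<ge> 1"
    and "\<beta> \<ge> -1" and "\<forall>j\<in>{1..n}. \<beta>s j \<ge> -1"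
    and "DIM('a) \<ge> 2 \<or> (DIM('a) = 1 \<and> \<beta> \<noteq> -1 \<and> (\<forall>j\<in>{1..n}. \<beta>s j \<noteq> -1))"
    and "beta_cone_vectors M n \<beta> \<beta>s Z Zs"
    and "\<And>\<omega>. C \<omega> = pos {Zs j \<omega> - Z \<omega> | j. j \<in> {1..n}}"
  shows "prob_space.expectation M
           (\<lambda>\<omega>. solid_angle (polar_cone (C \<omega>)) * indicator {\<omega>. C \<omega> \<noteq> UNIV} \<omega>) =
         (LBINT t:{-1..1}.
            c_beta (\<beta> + (real DIM('a) - 1) / 2) * (1 - t\<^sup>2) powr (\<beta> + (real DIM('a) - 1) / 2) *
            (\<Prod>j=1..n. LBINT s:{-1..t}.
               c_beta (\<beta>s j + (real DIM('a) - 1) / 2) *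
               (1 - s\<^sup>2) powr (\<beta>s j + (real DIM('a) - 1) / 2)))"
proof -
  interpret prob_space M by fact
  interpret N: prob_space "std_normal :: 'a measure" by (rule prob_space_std_normal)
  interpret MN: pair_sigma_finite M "std_normal :: 'a measure" ..
  define b where "b i = (if i = 0 then \<beta> else \<beta>s i)" for i
  define \<gamma> where "\<gamma> i = b i + (real DIM('a) - 1) / 2" for i
  \<comment> \<open>Nothing is assumed about \<open>Zs i\<close> beyond \<open>n\<close>. With the
    constant 0 there, all \<open>X i\<close> are random variables and all their laws are probability
    measures, as the results on product measures demand.\<close>
  define X where "X i = (if i = 0 then Z else if i \<le> n then Zs i else (\<lambda>_. 0))" for i
  define D where "D \<omega> = differences n (\<lambda>i. X i \<omega>)" for \<omega>
  let ?J = "{1..n}"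
  have b: "b i \<ge> -1" "DIM('a) \<ge> 2 \<or> b i \<noteq> -1" if "i \<in> {0..n}" for i
    using assms(3-5) that by (auto simp: b_def)
  have \<gamma>: "\<gamma> i > -1" if "i \<in> {0..n}" for i
  proof -
    have "real DIM('a) \<ge> 1" using DIM_positive[where 'a='a] by linarith
    moreover have "real DIM('a) \<ge> 2 \<or> b i > -1" using b[OF that] by auto
    ultimately show ?thesis unfolding \<gamma>_def using b(1)[OF that] by argo
  qed
  have indep0: "indep_vars (\<lambda>_. borel) (\<lambda>i. if i = 0 then Z else Zs i) {0..n}"
    and Z_distr: "distr M borel Z = beta_distr \<beta>"
    and Zs_distr: "\<forall>j\<in>?J. distr M borel (Zs j) = beta_distr (\<beta>s j)"
    using assms(6) unfolding beta_cone_vectors_def by auto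
  have indep: "indep_vars (\<lambda>_. borel) X {0..n}"
    using indep0 by (subst indep_vars_cong[of _ _ X "\<lambda>i. if i = 0 then Z else Zs i"]) (auto simp: X_def)
  have X_meas[measurable]: "X i \<in> borel_measurable M" for i
    using indep unfolding indep_vars_def by (cases "i \<in> {0..n}") (auto simp: X_def)
  have X_distr: "distr M borel (X i) = beta_distr (b i)" if "i \<in> {0..n}" for i
    using Z_distr Zs_distr that by (auto simp: X_def b_def)
  \<comment> \<open>Total mass 1 is read off from the law of \<open>X i\<close> rather than from the
    Gamma functions in the density.\<close>
  have beta_prob: "prob_space (beta_distr (b i) :: 'a measure)" if "i \<in> {0..n}" for i
    using prob_space_distr[OF X_meas[of i]] X_distr[OF that] by simp
  have D_meas[measurable]: "D \<in> borel_measurable M"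
  proof (rule measurable_coordinatewise_then_product)
    show "(\<lambda>\<omega>. D \<omega> j) \<in> borel_measurable M" for j
      unfolding D_def differences_def by (cases "j \<in> ?J") auto
  qed
  have D_comp[measurable]: "(\<lambda>\<omega>. D \<omega> j) \<in> borel_measurable M" for j
    unfolding D_def differences_def by (cases "j \<in> ?J") auto
  have C_eq: "C \<omega> = pos (D \<omega> ` ?J)" for \<omega>
  proof -
    have "{Zs j \<omega> - Z \<omega> | j. j \<in> ?J} = D \<omega> ` ?J"
      by (auto simp: D_def differences_def X_def image_def)
    then show ?thesis using assms(7) by simp
  qed
  define g where "g w = solid_angle (polar_cone (pos (w ` ?J))) * indicator {w. pos (w ` ?J) \<noteq> UNIV} w"
    for w :: "nat \<Rightarrow> 'a"
  have g_meas[measurable]: "g \<in> borel_measurable borel"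
    unfolding g_def by (rule measurable_solid_angle_polar) simp
  have g_nonneg: "g w \<ge> 0" for w by (simp add: g_def solid_angle_def)
  \<comment> \<open>There are only finitely many pairs of an index \<open>j\<close> and a set
    \<open>F\<close>, so the exceptional null sets combine into one.\<close>
  have g_generic: "AE \<omega> in M. g (D \<omega>) = measure std_normal {v. \<forall>j\<in>?J. v \<bullet> D \<omega> j \<le> 0}"
  proof -
    have "AE \<omega> in M. span (D \<omega> ` F) \<noteq> UNIV \<longrightarrow> D \<omega> j \<notin> span (D \<omega> ` F)"
      if j: "j \<in> ?J" and F: "F \<subseteq> ?J - {j}" for j F
    proof -
      let ?X = "\<lambda>\<omega>. \<lambda>i\<in>{0..n}. X i \<omega>"
      have "AE x in PiM {0..n} (\<lambda>i. distr M borel (X i)). span (differences n x ` F) \<noteq> UNIV \<longrightarrow>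
        differences n x j \<notin> span (differences n x ` F)"
      proof (rule AE_differences_nondegenerate[OF _ _ _ j F])
        show "prob_space (distr M borel (X i))" for i by (rule prob_space_distr) simp
        show "AE z in distr M borel (X j). z \<bullet> v \<noteq> t" if "v \<noteq> 0" for v t
        proof -
          have j': "j \<in> {0..n}" using j by auto
          show ?thesis
            unfolding X_distr[OF j'] by (rule beta_distr_hyperplane_null[OF beta_prob[OF j'] b[OF j'] that])
        qed
      qed simp
      also have "PiM {0..n} (\<lambda>i. distr M borel (X i)) = distr M (PiM {0..n} (\<lambda>_. borel)) ?X"
        using indep by (subst (asm) indep_vars_iff_distr_eq_PiM) auto
      finally have "AE \<omega> in M. span (differences n (?X \<omega>) ` F) \<noteq> UNIV \<longrightarrow>
        differences n (?X \<omega>) j \<notin> span (differences n (?X \<omega>) ` F)"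
        by (rule AE_distrD[rotated]) simp
      moreover have "differences n (?X \<omega>) = D \<omega>" for \<omega>
        by (auto simp: D_def differences_def fun_eq_iff)
      ultimately show ?thesis by simp
    qed
    then have "AE \<omega> in M. \<forall>j\<in>?J. \<forall>F\<in>Pow (?J - {j}). span (D \<omega> ` F) \<noteq> UNIV \<longrightarrow> D \<omega> j \<notin> span (D \<omega> ` F)"
      by (intro AE_finite_allI) auto
    then show ?thesis
      unfolding g_def by (elim eventually_mono, intro solid_angle_polar_generic) auto
  qed
  define \<nu> where "\<nu> i = density lborel (\<lambda>s. ennreal (beta_density (\<gamma> i) s))" for i
  have \<nu>_marg: "distr M borel (\<lambda>\<omega>. X i \<omega> \<bullet> u) = \<nu> i" if i: "i \<in> {0..n}" and u: "norm u = 1" for i u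
  proof -
    have "distr M borel (\<lambda>\<omega>. X i \<omega> \<bullet> u) = distr (distr M borel (X i)) borel (\<lambda>z. z \<bullet> u)"
      by (subst distr_distr) (auto simp: comp_def)
    also have "\<dots> = \<nu> i"
      unfolding X_distr[OF i] \<nu>_def \<gamma>_def beta_density_def
      by (rule beta_distr_marginal[OF beta_prob[OF i] b[OF i] u])
    finally show ?thesis .
  qed
  obtain u0 :: 'a where u0: "norm u0 = 1" using vector_choose_size[of 1] by auto
  have \<nu>_prob: "prob_space (\<nu> i)" if "i \<in> {0..n}" for i
    unfolding \<nu>_marg[OF that u0, symmetric] by (rule prob_space_distr) simp
  \<comment> \<open>Here \<open>t\<close> stands for the projection of \<open>Z\<close> to some
    direction. No direction enters the value, so averaging over the normal vector leaves it
    unchanged.\<close>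
  define R where "R = (\<integral>\<^sup>+t. (\<Prod>j=1..n. emeasure (\<nu> j) {..t}) \<partial>\<nu> 0)"
  have direction: "emeasure M {\<omega>\<in>space M. \<forall>j\<in>?J. x \<bullet> D \<omega> j \<le> 0} = R" if "x \<noteq> 0" for x
  proof -
    define u where "u = sgn x"
    have u: "norm u = 1" "x = norm x *\<^sub>R u" using that by (auto simp: u_def norm_sgn sgn_div_norm)
    have "x \<bullet> D \<omega> j \<le> 0 \<longleftrightarrow> X j \<omega> \<bullet> u \<le> X 0 \<omega> \<bullet> u" if "j \<in> ?J" for j \<omega>
    proof -
      have "x \<bullet> D \<omega> j = norm x * (X j \<omega> \<bullet> u - X 0 \<omega> \<bullet> u)"
        using that by (subst u(2)) (simp add: D_def differences_def inner_diff_right inner_commute right_diff_distrib)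
      then show ?thesis using \<open>x \<noteq> 0\<close> by (simp add: mult_le_0_iff)
    qed
    then have "{\<omega>\<in>space M. \<forall>j\<in>?J. x \<bullet> D \<omega> j \<le> 0} = {\<omega>\<in>space M. \<forall>j\<in>?J. X j \<omega> \<bullet> u \<le> X 0 \<omega> \<bullet> u}"
      by auto
    also have "emeasure M \<dots> = (\<integral>\<^sup>+t. (\<Prod>j=1..n. emeasure (distr M borel (\<lambda>\<omega>. X j \<omega> \<bullet> u)) {..t})
        \<partial>distr M borel (\<lambda>\<omega>. X 0 \<omega> \<bullet> u))"
      by (rule emeasure_all_le_first) (auto intro!: indep_vars_compose2[OF indep])
    also have "\<dots> = R"
      unfolding R_def using u(1) by (simp add: \<nu>_marg)
    finally show ?thesis .
  qed
  have "(\<integral>\<^sup>+\<omega>. ennreal (g (D \<omega>)) \<partial>M) =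
    (\<integral>\<^sup>+\<omega>. \<integral>\<^sup>+x. indicator {x. \<forall>j\<in>?J. x \<bullet> D \<omega> j \<le> 0} x \<partial>std_normal \<partial>M)"
    using g_generic
  proof (intro nn_integral_cong_AE, eventually_elim)
    fix \<omega> assume "g (D \<omega>) = measure std_normal {v. \<forall>j\<in>?J. v \<bullet> D \<omega> j \<le> 0}"
    moreover have "{v. \<forall>j\<in>?J. v \<bullet> D \<omega> j \<le> 0} \<in> sets borel"
      by (intro borel_closed closed_polar_halfspaces)
    ultimately show "ennreal (g (D \<omega>)) = (\<integral>\<^sup>+x. indicator {x. \<forall>j\<in>?J. x \<bullet> D \<omega> j \<le> 0} x \<partial>std_normal)"
      by (simp add: N.emeasure_eq_measure)
  qed
  \<comment> \<open>The exchange turns the mean normal measure of the random polar cone into the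
    normal average of the probability that a fixed \<open>x\<close> is polar, which is
    \<open>R\<close> for every \<open>x \<noteq> 0\<close>.\<close>
  also have "\<dots> = (\<integral>\<^sup>+x. \<integral>\<^sup>+\<omega>. indicator {x. \<forall>j\<in>?J. x \<bullet> D \<omega> j \<le> 0} x \<partial>M \<partial>std_normal)"
    unfolding indicator_def by (rule MN.Fubini'[symmetric]) measurable
  also have "\<dots> = (\<integral>\<^sup>+x. R \<partial>(std_normal :: 'a measure))"
  proof (rule nn_integral_cong_AE)
    have "AE x in lborel. (x :: 'a) \<noteq> 0"
      using AE_not_in[of "{0 :: 'a}" lborel] by (simp add: null_setsI)
    then have "AE x in std_normal. (x :: 'a) \<noteq> 0"
      unfolding std_normal_def by (subst AE_density) (auto elim: eventually_mono)
    then show "AE x in std_normal. (\<integral>\<^sup>+\<omega>. indicator {x. \<forall>j\<in>?J. x \<bullet> D \<omega> j \<le> 0} x \<partial>M) = R"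
    proof eventually_elim
      fix x :: 'a assume x: "x \<noteq> 0"
      have "(\<integral>\<^sup>+\<omega>. indicator {x. \<forall>j\<in>?J. x \<bullet> D \<omega> j \<le> 0} x \<partial>M) =
        (\<integral>\<^sup>+\<omega>. indicator {\<omega>\<in>space M. \<forall>j\<in>?J. x \<bullet> D \<omega> j \<le> 0} \<omega> \<partial>M)"
        by (intro nn_integral_cong) (auto split: split_indicator)
      also have "\<dots> = emeasure M {\<omega>\<in>space M. \<forall>j\<in>?J. x \<bullet> D \<omega> j \<le> 0}"
        by (rule nn_integral_indicator) measurable
      finally show "(\<integral>\<^sup>+\<omega>. indicator {x. \<forall>j\<in>?J. x \<bullet> D \<omega> j \<le> 0} x \<partial>M) = R"
        using direction[OF x] by simp
    qed
  qed
  also have "\<dots> = R" using N.emeasure_space_1 by simp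
  finally have LHS: "expectation (\<lambda>\<omega>. g (D \<omega>)) = enn2real R"
    using g_nonneg by (subst integral_eq_nn_integral) auto
  have cdf_meas[measurable]: "(\<lambda>t. measure (\<nu> j) {..t}) \<in> borel_measurable borel" if "j \<in> {0..n}" for j
  proof (rule borel_measurable_mono)
    interpret \<nu>: prob_space "\<nu> j" by (rule \<nu>_prob[OF that])
    show "mono (\<lambda>t. measure (\<nu> j) {..t})"
      by (intro monoI \<nu>.finite_measure_mono) (auto simp: \<nu>_def)
  qed
  have prod_meas[measurable]: "(\<lambda>t. \<Prod>j=1..n. measure (\<nu> j) {..t}) \<in> borel_measurable borel"
    by (intro borel_measurable_prod cdf_meas) auto
  \<comment> \<open>Probability measures are finite, so the product passes from extended nonnegative
    to real numbers, where the claimed integrals live.\<close>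
  have prod_eq: "(\<Prod>j=1..n. emeasure (\<nu> j) {..t}) = ennreal (\<Prod>j=1..n. measure (\<nu> j) {..t})" for t
  proof -
    have "emeasure (\<nu> j) {..t} = ennreal (measure (\<nu> j) {..t})" if "j \<in> ?J" for j
      using \<nu>_prob[of j] that by (intro finite_measure.emeasure_eq_measure) (auto simp: prob_space_def)
    then show ?thesis by (simp add: prod_ennreal)
  qed
  have \<gamma>0: "\<gamma> 0 > -1" by (rule \<gamma>) simp
  have "R = (\<integral>\<^sup>+t. ennreal (beta_density (\<gamma> 0) t * (\<Prod>j=1..n. measure (\<nu> j) {..t})) \<partial>lborel)"
    unfolding R_def prod_eq using beta_density_nonneg[OF \<gamma>0]
    by (subst \<nu>_def, subst nn_integral_density) (auto simp: ennreal_mult' intro!: nn_integral_cong)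
  then have "enn2real R = (\<integral>t. beta_density (\<gamma> 0) t * (\<Prod>j=1..n. measure (\<nu> j) {..t}) \<partial>lborel)"
    using beta_density_nonneg[OF \<gamma>0]
    by (subst integral_eq_nn_integral) (auto intro!: mult_nonneg_nonneg prod_nonneg)
  also have "\<dots> = (LBINT t:{-1..1}. c_beta (\<gamma> 0) * (1 - t\<^sup>2) powr \<gamma> 0 *
      (\<Prod>j=1..n. LBINT s:{-1..t}. c_beta (\<gamma> j) * (1 - s\<^sup>2) powr \<gamma> j))"
    unfolding set_lebesgue_integral_def[of lborel "{-1..1}"]
  proof (rule Bochner_Integration.integral_cong)
    fix t :: real
    show "beta_density (\<gamma> 0) t * (\<Prod>j=1..n. measure (\<nu> j) {..t}) =
      indicat_real {-1..1} t *\<^sub>R (c_beta (\<gamma> 0) * (1 - t\<^sup>2) powr \<gamma> 0 *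
      (\<Prod>j=1..n. LBINT s:{-1..t}. c_beta (\<gamma> j) * (1 - s\<^sup>2) powr \<gamma> j))"
    \<comment> \<open>Outside \<open>{-1..1}\<close> both sides are 0; inside,
      \<open>t \<le> 1\<close> permits \<open>beta_distribution_function\<close>.\<close>
    proof (cases "t \<in> {-1..1}")
      case True
      then have "(\<Prod>j=1..n. LBINT s:{-1..t}. c_beta (\<gamma> j) * (1 - s\<^sup>2) powr \<gamma> j) =
        (\<Prod>j=1..n. measure (\<nu> j) {..t})"
        unfolding \<nu>_def using \<gamma> by (intro prod.cong refl beta_distribution_function) auto
      then show ?thesis using True by (simp add: beta_density_def)
    qed (simp add: beta_density_def)
  qed simp
  also have "\<dots> = (LBINT t:{-1..1}. c_beta (\<beta> + (real DIM('a) - 1) / 2) * (1 - t\<^sup>2) powr (\<beta> + (real DIM('a) - 1) / 2) *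
      (\<Prod>j=1..n. LBINT s:{-1..t}. c_beta (\<beta>s j + (real DIM('a) - 1) / 2) *
        (1 - s\<^sup>2) powr (\<beta>s j + (real DIM('a) - 1) / 2)))"
  proof -
    have "(\<Prod>j=1..n. LBINT s:{-1..t}. c_beta (\<gamma> j) * (1 - s\<^sup>2) powr \<gamma> j) =
      (\<Prod>j=1..n. LBINT s:{-1..t}. c_beta (\<beta>s j + (real DIM('a) - 1) / 2) *
        (1 - s\<^sup>2) powr (\<beta>s j + (real DIM('a) - 1) / 2))" for t
      by (intro prod.cong refl) (simp add: \<gamma>_def b_def)
    moreover have "\<gamma> 0 = \<beta> + (real DIM('a) - 1) / 2" by (simp add: \<gamma>_def b_def)
    ultimately show ?thesis by (simp only:)
  qed
  finally have RHS: "enn2real R = \<dots>" .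
  have "(\<lambda>\<omega>. solid_angle (polar_cone (C \<omega>)) * indicator {\<omega>. C \<omega> \<noteq> UNIV} \<omega>) = (\<lambda>\<omega>. g (D \<omega>))"
    by (auto simp: g_def C_eq indicator_def)
  then show ?thesis using LHS RHS by simp
qed

end
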